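(* Let $Z=\{P_1,\dots,P_r\}\subset\mathbb{P}^2$ be a finite set of points. If $\alpha(I(kZ))-\alpha(I((k-1)Z))=1$ for some integer $k\ge2$, then either (a) the points of $Z$ are collinear, or (b) $Z$ consists of all intersection points of some arrangement of lines (which might be non-reduced and degenerate, i.e. containing points through which more than two lines pass).
   Context: Work over an algebraically closed field $\mathbb{K}$ of characteristic zero, $R=\mathbb{K}[x_0,x_1,x_2]$. For $Z=\{P_1,\dots,P_r\}$, $I(P_i)$ is the homogeneous maximal ideal of $P_i$ and $I(kZ)=I(P_1)^k\cap\dots\cap I(P_r)^k$ (the $k$-th symbolic power of $I(Z)$). For a homogeneous ideal $J$, $\alpha(J)=\min\{n:J_n\ne0\}$ is its initial degree. *)

theory Defs
  imports "HOL-Library.Poly_Mapping" "HOL-Library.Product_Plus"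
          "HOL-Computational_Algebra.Polynomial"
begin

text \<open>Polynomials in R = K[x0,x1,x2]: finitely supported maps from exponent
  triples (i,j,l), standing for x0^i x1^j x2^l, to coefficients.  With the
  convolution product of Poly_Mapping this is the polynomial ring.\<close>

type_synonym 'a poly3 = "(nat \<times> nat \<times> nat) \<Rightarrow>\<^sub>0 'a"

text \<open>Points of P^2 are given by nonzero homogeneous coordinate vectors.\<close>
type_synonym 'a pt = "'a \<times> 'a \<times> 'a"

definition mdeg :: "nat \<times> nat \<times> nat \<Rightarrow> nat" where
  "mdeg m = fst m + fst (snd m) + snd (snd m)"

text \<open>F is homogeneous of degree n (the zero polynomial is homogeneous of every degree).\<close>
definition homogeneous :: "'a::zero poly3 \<Rightarrow> nat \<Rightarrow> bool" where
  "homogeneous F n \<longleftrightarrow> (\<forall>m\<in>Poly_Mapping.keys F. mdeg m = n)"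

definition peval :: "'a::comm_semiring_1 poly3 \<Rightarrow> 'a pt \<Rightarrow> 'a" where
  "peval F p = (\<Sum>m\<in>Poly_Mapping.keys F. Poly_Mapping.lookup F m * fst p ^ fst m * fst (snd p) ^ fst (snd m)
                              * snd (snd p) ^ snd (snd m))"

inductive_set ideal_gen :: "'a::comm_ring_1 set \<Rightarrow> 'a set" for S where
  zero: "0 \<in> ideal_gen S"
| step: "s \<in> S \<Longrightarrow> f \<in> ideal_gen S \<Longrightarrow> r * s + f \<in> ideal_gen S"

definition ideal_prod :: "'a::comm_ring_1 set \<Rightarrow> 'a set \<Rightarrow> 'a set" where
  "ideal_prod I J = ideal_gen {a * b | a b. a \<in> I \<and> b \<in> J}"

primrec ideal_power :: "'a::comm_ring_1 set \<Rightarrow> nat \<Rightarrow> 'a set" where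
  "ideal_power I 0 = UNIV"
| "ideal_power I (Suc k) = ideal_prod (ideal_power I k) I"

definition point_ideal :: "'a::comm_ring_1 pt \<Rightarrow> 'a poly3 set" where
  "point_ideal P = ideal_gen {F. (\<exists>n. homogeneous F n) \<and> peval F P = 0}"

definition fat_ideal :: "'a::comm_ring_1 pt set \<Rightarrow> nat \<Rightarrow> 'a poly3 set" where
  "fat_ideal Z k = (\<Inter>P\<in>Z. ideal_power (point_ideal P) k)"

definition initial_degree :: "'a::comm_ring_1 poly3 set \<Rightarrow> nat" where
  "initial_degree J = (LEAST n. \<exists>F\<in>J. F \<noteq> 0 \<and> homogeneous F n)"

definition lin :: "'a::comm_ring_1 pt \<Rightarrow> 'a pt \<Rightarrow> 'a" where
  "lin L P = fst L * fst P + fst (snd L) * fst (snd P) + snd (snd L) * snd (snd P)"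

text \<open>Two coordinate vectors represent the same projective point / line.\<close>
definition proportional :: "'a::field pt \<Rightarrow> 'a pt \<Rightarrow> bool" where
  "proportional u v \<longleftrightarrow> (\<exists>c. c \<noteq> 0 \<and> v = (c * fst u, c * fst (snd u), c * snd (snd u)))"

definition collinear_pts :: "'a::field pt set \<Rightarrow> bool" where
  "collinear_pts Z \<longleftrightarrow> (\<exists>L. L \<noteq> (0,0,0) \<and> (\<forall>P\<in>Z. lin L P = 0))"

text \<open>Z (as a set of projective points) is exactly the set of points lying on at least
  two distinct lines of the finite arrangement A (lines may repeat in A only up to
  scalars, which does not affect the intersection points; multiplicities are irrelevant).\<close>
definition intersection_points_of_arrangement :: "'a::field pt set \<Rightarrow> bool" where
  "intersection_points_of_arrangement Z \<longleftrightarrow>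
     (\<exists>A. finite A \<and> (\<forall>L\<in>A. L \<noteq> (0,0,0)) \<and>
       (\<forall>P. P \<noteq> (0,0,0) \<longrightarrow>
          ((\<exists>Q\<in>Z. proportional Q P) \<longleftrightarrow>
           (\<exists>L1\<in>A. \<exists>L2\<in>A. \<not> proportional L1 L2 \<and> lin L1 P = 0 \<and> lin L2 P = 0))))"

end

theory Submission
  imports Defs "Berlekamp_Zassenhaus.Unique_Factorization_Poly" "HOL-Library.Product_Lexorder"
begin

text \<open>Let \<open>F\<close> be a form of degree \<open>d = \<alpha>(I(kZ))\<close> in \<open>I(kZ)\<close>; the hypothesis says that no nonzero form of
  degree \<open>d - 2\<close> lies in \<open>I((k-1)Z)\<close>.

  All components of \<open>F\<close> are lines. Let \<open>C\<close> be an irreducible component of degree \<open>e \<ge> 2\<close> with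
  multiplicities \<open>m P\<close> at the points of \<open>Z\<close>. Bezout's inequality for \<open>C\<close> and its polar curve with
  respect to a point \<open>Q \<in> Z\<close> on \<open>C\<close>, which has multiplicity \<open>m Q\<close> (and not just \<open>m Q - 1\<close>) at \<open>Q\<close>, gives
  \<open>\<Sum>P. m P (m P - 1) < e (e - 1)\<close>. Counting coefficients, there is a form \<open>H \<noteq> 0\<close> of degree \<open>e - 2\<close>
  with multiplicity at least \<open>m P - 1\<close> at every \<open>P\<close>, and replacing \<open>C\<close> by \<open>H\<close> in \<open>F\<close> yields a form of
  degree \<open>d - 2\<close> in \<open>I((k-1)Z)\<close>.

  So \<open>F\<close> is a product of \<open>d\<close> lines. If two different lines of \<open>F\<close> meet outside \<open>Z\<close>, deleting both lowers
  no multiplicity on \<open>Z\<close> by more than one. If all lines of \<open>F\<close> through some \<open>P \<in> Z\<close> agree with one line \<open>L\<close>,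
  then \<open>L\<close> occurs at least \<open>k\<close> times, and \<open>L\<close> can be deleted together with a line through a point of \<open>Z\<close>
  outside \<open>L\<close>. Both contradict the hypothesis.\<close>

section \<open>Trivariate polynomials\<close>

text \<open>The lexicographic order on exponent triples thereby becomes a monomial order:
  \<open>poly3\<close> over a domain has no zero divisors, and leading monomials add up under
  multiplication (\<open>lookup_mult_Max\<close>).\<close>

instance prod :: ("{ordered_cancel_comm_monoid_add,linorder}","{ordered_cancel_comm_monoid_add,linorder}")
    ordered_cancel_comm_monoid_add
proof
  fix a b c :: "'a \<times> 'b"
  show "a \<le> b \<Longrightarrow> c + a \<le> c + b"
    by (auto simp: less_eq_prod_def add_strict_left_mono add_left_mono)
qed

definition const3 :: "'a::zero \<Rightarrow> 'a poly3" where "const3 c = Poly_Mapping.single 0 c"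
definition X3 :: "'a::zero_neq_one poly3" where "X3 = Poly_Mapping.single (1,0,0) 1"
definition Y3 :: "'a::zero_neq_one poly3" where "Y3 = Poly_Mapping.single (0,1,0) 1"
definition Z3 :: "'a::zero_neq_one poly3" where "Z3 = Poly_Mapping.single (0,0,1) 1"

definition mono_eval :: "'b::comm_semiring_1 \<Rightarrow> 'b \<Rightarrow> 'b \<Rightarrow> nat \<times> nat \<times> nat \<Rightarrow> 'b" where
  "mono_eval x y z m = x ^ fst m * y ^ fst (snd m) * z ^ snd (snd m)"

text \<open>With \<open>h\<close> the identity this is evaluation at a point, with
  \<open>h = const3\<close> it is substitution of polynomials for the variables, hence a change of
  coordinates.\<close>

definition eval3 :: "('a::zero \<Rightarrow> 'b::comm_semiring_1) \<Rightarrow> 'b \<Rightarrow> 'b \<Rightarrow> 'b \<Rightarrow> 'a poly3 \<Rightarrow> 'b" where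
  "eval3 h x y z F = (\<Sum>m\<in>Poly_Mapping.keys F. h (Poly_Mapping.lookup F m) * mono_eval x y z m)"

lemma mono_eval_add: "mono_eval x y z (m + m') = mono_eval x y z m * mono_eval x y z m'"
  by (simp add: mono_eval_def power_add algebra_simps)

lemma mono_eval_simps [simp]:
  "mono_eval x y z 0 = 1" "mono_eval x y z (0,0,0) = 1"
  by (simp_all add: mono_eval_def zero_prod_def)

interpretation const3: comm_ring_hom "const3 :: 'a::comm_ring_1 \<Rightarrow> 'a poly3"
  by unfold_locales (simp_all add: const3_def single_add Poly_Mapping.mult_single flip: single_one)

lemma const3_eq_0_iff [simp]: "const3 c = 0 \<longleftrightarrow> c = 0"
  by (metis const3_def lookup_single_eq lookup_zero single_zero)

lemma const3_mult_single: "const3 c * Poly_Mapping.single m b = Poly_Mapping.single m (c * b)"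
  by (simp add: const3_def Poly_Mapping.mult_single)

lemma sum_single_lookup: "(\<Sum>m\<in>Poly_Mapping.keys F. Poly_Mapping.single m (Poly_Mapping.lookup F m)) = F"
  by (rule poly_mapping_eqI) (auto simp: lookup_sum lookup_single when_def in_keys_iff)

lemma poly3_induct [case_names monom add]:
  fixes F :: "'a::comm_monoid_add poly3"
  assumes "\<And>m c. Q (Poly_Mapping.single m c)" "\<And>F G. Q F \<Longrightarrow> Q G \<Longrightarrow> Q (F + G)"
  shows "Q F"
proof -
  have "Q (\<Sum>m\<in>M. Poly_Mapping.single m (Poly_Mapping.lookup F m))" if "finite M" for M
    using that
  proof (induction M)
    case empty
    show ?case using assms(1)[of 0 0] by simp
  next
    case (insert m M)
    then show ?case using assms(2)[OF assms(1) insert.IH] by simp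
  qed
  from this[of "Poly_Mapping.keys F"] show ?thesis
    by (simp add: sum_single_lookup)
qed

lemma single_0_one: "Poly_Mapping.single (0,0,0) 1 = (1 :: 'a::comm_semiring_1 poly3)"
  by (simp add: single_one flip: zero_prod_def)

lemma X3_power: "X3 ^ n = Poly_Mapping.single (n,0,0) (1::'a::comm_semiring_1)"
  by (induction n) (simp_all add: X3_def Poly_Mapping.mult_single single_0_one)
lemma Y3_power: "Y3 ^ n = Poly_Mapping.single (0,n,0) (1::'a::comm_semiring_1)"
  by (induction n) (simp_all add: Y3_def Poly_Mapping.mult_single single_0_one)
lemma Z3_power: "Z3 ^ n = Poly_Mapping.single (0,0,n) (1::'a::comm_semiring_1)"
  by (induction n) (simp_all add: Z3_def Poly_Mapping.mult_single single_0_one)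

lemma single_eq_mono:
  "Poly_Mapping.single m c = const3 (c::'a::comm_semiring_1) * mono_eval X3 Y3 Z3 m"
  by (cases m) (simp add: mono_eval_def X3_power Y3_power Z3_power const3_def Poly_Mapping.mult_single)

context
  fixes h :: "'a::comm_ring_1 \<Rightarrow> 'b::comm_ring_1" and x y z :: 'b
  assumes h: "comm_ring_hom h"
begin

interpretation h: comm_ring_hom h by (fact h)

lemma eval3_superset:
  assumes "finite M" "Poly_Mapping.keys F \<subseteq> M"
  shows "eval3 h x y z F = (\<Sum>m\<in>M. h (Poly_Mapping.lookup F m) * mono_eval x y z m)"
  unfolding eval3_def
  by (rule sum.mono_neutral_left) (use assms in \<open>auto simp: in_keys_iff\<close>)

lemma eval3_single: "eval3 h x y z (Poly_Mapping.single m c) = h c * mono_eval x y z m"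
  by (subst eval3_superset[of "{m}"]) auto

lemma eval3_add: "eval3 h x y z (F + G) = eval3 h x y z F + eval3 h x y z G"
proof -
  let ?M = "Poly_Mapping.keys F \<union> Poly_Mapping.keys G"
  have "Poly_Mapping.keys (F + G) \<subseteq> ?M" by (rule Poly_Mapping.keys_add)
  then show ?thesis
    by (simp add: eval3_superset[of ?M] lookup_add h.hom_add distrib_right sum.distrib)
qed

lemma eval3_mult: "eval3 h x y z (F * G) = eval3 h x y z F * eval3 h x y z G"
proof (induction F rule: poly3_induct)
  case (monom m c)
  show ?case
    by (induction G rule: poly3_induct)
      (simp_all add: Poly_Mapping.mult_single eval3_single mono_eval_add eval3_add h.hom_mult algebra_simps)
qed (simp add: eval3_add distrib_right)

lemma eval3_hom: "comm_ring_hom (eval3 h x y z)"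
proof
  show "eval3 h x y z 1 = 1"
    by (simp add: eval3_single flip: single_one)
qed (auto simp: eval3_add eval3_mult, simp add: eval3_def)

lemma eval3_const3: "eval3 h x y z (const3 c) = h c"
  by (simp add: const3_def eval3_single)

lemma eval3_vars:
  "eval3 h x y z X3 = x" "eval3 h x y z Y3 = y" "eval3 h x y z Z3 = z"
  by (simp_all add: X3_def Y3_def Z3_def eval3_single mono_eval_def)

end

text \<open>Universal property of the polynomial ring: monomials are products of constants and
  variables. It reduces statements about coordinate changes to the three variables.\<close>

lemma poly3_hom_eqI:
  assumes "comm_ring_hom f" "comm_ring_hom g"
    and "\<And>c. f (const3 c) = g (const3 c)" "f X3 = g X3" "f Y3 = g Y3" "f Z3 = g Z3"
  shows "f F = g F"
proof -
  interpret f: comm_ring_hom f by fact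
  interpret g: comm_ring_hom g by fact
  show ?thesis
    by (induction F rule: poly3_induct)
      (simp_all add: f.hom_add g.hom_add single_eq_mono mono_eval_def f.hom_mult g.hom_mult
        f.hom_power g.hom_power assms)
qed

lemma peval_eq_eval3: "peval F p = eval3 (\<lambda>c. c) (fst p) (fst (snd p)) (snd (snd p)) F"
  by (simp add: peval_def eval3_def mono_eval_def mult.assoc)

lemma ring_hom_id: "comm_ring_hom (\<lambda>c::'a::comm_ring_1. c)"
  by unfold_locales auto

interpretation peval: comm_ring_hom "\<lambda>F. peval F (p::'a::comm_ring_1 pt)"
  unfolding peval_eq_eval3 by (rule eval3_hom[OF ring_hom_id])

lemma peval_simps [simp]:
  fixes p :: "'a::comm_ring_1 pt"
  shows "peval (const3 c) p = c" "peval X3 p = fst p" "peval Y3 p = fst (snd p)" "peval Z3 p = snd (snd p)"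
  by (simp_all add: peval_eq_eval3 eval3_const3[OF ring_hom_id] eval3_vars[OF ring_hom_id])

section \<open>Weights\<close>

lemma mdeg_add [simp]: "mdeg (m + m') = mdeg m + mdeg m'"
  by (simp add: mdeg_def)
lemma mdeg_0 [simp]: "mdeg 0 = 0" "mdeg (a,b,c) = a + b + c"
  by (simp_all add: mdeg_def)

text \<open>Each monomial \<open>m\<close> is multiplied by \<open>t ^ w m\<close> for a new
  variable \<open>t\<close>. For additive \<open>w\<close> this is an injective ring homomorphism,
  so degrees (\<open>mdeg\<close>) and orders at a point (\<open>vorder\<close>) become degrees and
  orders of univariate polynomials in \<open>t\<close>.\<close>

definition weight_hom :: "(nat \<times> nat \<times> nat \<Rightarrow> nat) \<Rightarrow> 'a::comm_ring_1 poly3 \<Rightarrow> 'a poly3 poly" where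
  "weight_hom w F = (\<Sum>m\<in>Poly_Mapping.keys F. Polynomial.monom (Poly_Mapping.single m (Poly_Mapping.lookup F m)) (w m))"

lemma lookup_coeff_weight_hom:
  "Poly_Mapping.lookup (Polynomial.coeff (weight_hom w F) n) m = (if w m = n then Poly_Mapping.lookup F m else 0)"
proof -
  have "Poly_Mapping.lookup (Polynomial.coeff (weight_hom w F) n) m
      = (\<Sum>m'\<in>Poly_Mapping.keys F. if m' = m then if w m = n then Poly_Mapping.lookup F m else 0 else 0)"
    unfolding weight_hom_def coeff_sum lookup_sum
    by (rule sum.cong) (auto simp: lookup_single when_def)
  also have "\<dots> = (if w m = n then Poly_Mapping.lookup F m else 0)"
    by (auto simp: in_keys_iff)
  finally show ?thesis .
qed

lemma weight_hom_single: "weight_hom w (Poly_Mapping.single m c) = Polynomial.monom (Poly_Mapping.single m c) (w m)"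
  by (rule poly_eqI, rule poly_mapping_eqI) (auto simp: lookup_coeff_weight_hom lookup_single when_def)

lemma weight_hom_add: "weight_hom w (F + G) = weight_hom w F + weight_hom w G"
  by (rule poly_eqI, rule poly_mapping_eqI) (auto simp: lookup_coeff_weight_hom lookup_add)

lemma weight_hom_mult:
  assumes "\<And>m m'. w (m + m') = w m + w m'"
  shows "weight_hom w (F * G) = weight_hom w F * weight_hom w G"
proof (induction F rule: poly3_induct)
  case (monom m c)
  show ?case
    by (induction G rule: poly3_induct)
      (simp_all add: Poly_Mapping.mult_single weight_hom_single weight_hom_add mult_monom assms algebra_simps)
qed (simp add: weight_hom_add distrib_right)

lemma weight_hom_eq_0_iff [simp]: "weight_hom w F = 0 \<longleftrightarrow> F = 0"
proof
  assume "weight_hom w F = 0"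
  then show "F = 0"
    by (metis lookup_coeff_weight_hom lookup_zero poly_mapping_eqI coeff_0)
qed (simp add: weight_hom_def)

lemma homogeneous_iff_weight_hom:
  fixes F :: "'a::comm_ring_1 poly3"
  shows "homogeneous F n \<longleftrightarrow> weight_hom mdeg F = Polynomial.monom F n"
proof
  assume "homogeneous F n"
  then show "weight_hom mdeg F = Polynomial.monom F n"
    by (intro poly_eqI poly_mapping_eqI) (auto simp: lookup_coeff_weight_hom homogeneous_def in_keys_iff)
next
  assume *: "weight_hom mdeg F = Polynomial.monom F n"
  show "homogeneous F n"
    unfolding homogeneous_def
  proof
    fix m assume "m \<in> Poly_Mapping.keys F"
    then have "Poly_Mapping.lookup (Polynomial.coeff (weight_hom mdeg F) (mdeg m)) m \<noteq> 0"
      by (simp add: lookup_coeff_weight_hom in_keys_iff)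
    then show "mdeg m = n"
      unfolding * by (auto split: if_splits)
  qed
qed

lemma homogeneous_mult:
  fixes F G :: "'a::comm_ring_1 poly3"
  shows "homogeneous F n \<Longrightarrow> homogeneous G k \<Longrightarrow> homogeneous (F * G) (n + k)"
  by (simp add: homogeneous_iff_weight_hom weight_hom_mult mult_monom)

lemma homogeneous_add:
  fixes F G :: "'a::comm_ring_1 poly3"
  shows "homogeneous F n \<Longrightarrow> homogeneous G n \<Longrightarrow> homogeneous (F + G) n"
  by (simp add: homogeneous_iff_weight_hom weight_hom_add add_monom)

lemma homogeneous_0 [simp]: "homogeneous 0 n"
  by (simp add: homogeneous_def)

lemma homogeneous_single: "mdeg m = n \<Longrightarrow> homogeneous (Poly_Mapping.single m c) n"
  by (simp add: homogeneous_def)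

lemma homogeneous_const3 [simp]: "homogeneous (const3 c) 0"
  by (simp add: const3_def homogeneous_single)

lemma homogeneous_sum:
  fixes f :: "'i \<Rightarrow> 'a::comm_ring_1 poly3"
  shows "(\<And>i. i \<in> I \<Longrightarrow> homogeneous (f i) n) \<Longrightarrow> homogeneous (\<Sum>i\<in>I. f i) n"
  by (induction I rule: infinite_finite_induct) (auto intro: homogeneous_add)

lemma homogeneous_1 [simp]: "homogeneous (1 :: 'a::comm_ring_1 poly3) 0"
  using homogeneous_const3[of "1::'a"] by simp

lemma homogeneous_const_mult:
  fixes F :: "'a::comm_ring_1 poly3"
  shows "homogeneous F n \<Longrightarrow> homogeneous (const3 c * F) n"
  using homogeneous_mult[of "const3 c" 0 F n] by simp

lemma homogeneous_power:
  fixes F :: "'a::comm_ring_1 poly3"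
  shows "homogeneous F n \<Longrightarrow> homogeneous (F ^ k) (k * n)"
  by (induction k) (auto intro: homogeneous_mult)

lemma homogeneous_prod:
  fixes f :: "'i \<Rightarrow> 'a::comm_ring_1 poly3"
  shows "(\<And>i. i \<in> I \<Longrightarrow> homogeneous (f i) (n i)) \<Longrightarrow> homogeneous (\<Prod>i\<in>I. f i) (\<Sum>i\<in>I. n i)"
  by (induction I rule: infinite_finite_induct) (auto intro: homogeneous_mult)

lemma homogeneous_unique: "homogeneous F n \<Longrightarrow> homogeneous F k \<Longrightarrow> F \<noteq> 0 \<Longrightarrow> n = k"
  unfolding homogeneous_def by (metis all_not_in_conv keys_eq_empty)

text \<open>Over a domain both the order at 0 and the degree are additive, and they agree for the
  product; as the order never exceeds the degree, they agree for the factor \<open>p\<close> as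
  well.\<close>

lemma mult_eq_monomD:
  fixes p q :: "'a::idom poly"
  assumes eq: "p * q = Polynomial.monom c n" and "c \<noteq> 0"
  shows "p = Polynomial.monom (Polynomial.lead_coeff p) (Polynomial.degree p)"
proof -
  have nz: "p \<noteq> 0" "q \<noteq> 0" using assms by auto
  have "Polynomial.order 0 (Polynomial.monom c n) = n" 
    using \<open>c \<noteq> 0\<close> by (subst order_0_monom) auto
  then have "Polynomial.order 0 p + Polynomial.order 0 q = n"
    using order_mult[of p q 0] nz eq \<open>c \<noteq> 0\<close> by simp
  moreover have "Polynomial.degree p + Polynomial.degree q = n"
    using degree_mult_eq[OF nz] eq \<open>c \<noteq> 0\<close> by (simp add: degree_monom_eq)
  moreover have "Polynomial.order 0 p \<le> Polynomial.degree p" "Polynomial.order 0 q \<le> Polynomial.degree q"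
    using nz by (auto intro: order_degree)
  ultimately have "Polynomial.order 0 p = Polynomial.degree p" by linarith
  then have "Polynomial.monom 1 (Polynomial.degree p) dvd p"
    using monom_1_dvd_iff[OF nz(1)] by simp
  then have "Polynomial.coeff p k = 0" if "k < Polynomial.degree p" for k
    using that by (simp add: monom_1_dvd_iff')
  then show ?thesis
    by (intro poly_eqI) (metis Polynomial.coeff_monom coeff_eq_0 linorder_neqE_nat)
qed

text \<open>Under \<open>weight_hom mdeg\<close> a form becomes a monomial in \<open>t\<close>, and
  the factors of a monomial are monomials.\<close>

lemma homogeneous_factor:
  fixes F G :: "'a::idom poly3"
  assumes "homogeneous (F * G) n" "F * G \<noteq> 0"
  shows "\<exists>k. homogeneous F k"
proof -
  have "weight_hom mdeg F * weight_hom mdeg G = Polynomial.monom (F * G) n"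
    using assms by (simp add: homogeneous_iff_weight_hom flip: weight_hom_mult)
  from mult_eq_monomD[OF this assms(2)] obtain H k where *: "weight_hom mdeg F = Polynomial.monom H k"
    by blast
  have "mdeg m = k" if "m \<in> Poly_Mapping.keys F" for m
  proof -
    have "Poly_Mapping.lookup (Polynomial.coeff (weight_hom mdeg F) (mdeg m)) m \<noteq> 0"
      using that by (simp add: lookup_coeff_weight_hom in_keys_iff)
    then show ?thesis
      unfolding * by (auto split: if_splits)
  qed
  then show ?thesis unfolding homogeneous_def by blast
qed

section \<open>Ideals\<close>

lemma ideal_gen_superset: "s \<in> S \<Longrightarrow> s \<in> ideal_gen S"
  using ideal_gen.step[of s S 0 1] ideal_gen.zero[of S] by simp

lemma ideal_gen_add: "f \<in> ideal_gen S \<Longrightarrow> g \<in> ideal_gen S \<Longrightarrow> f + g \<in> ideal_gen S"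
  by (induction f rule: ideal_gen.induct) (auto simp: add.assoc intro: ideal_gen.step)

lemma ideal_gen_mult: "f \<in> ideal_gen S \<Longrightarrow> a * f \<in> ideal_gen S"
proof (induction f rule: ideal_gen.induct)
  case (step s f r)
  then show ?case
    using ideal_gen.step[of s S "a * f" "a * r"] by (simp add: algebra_simps)
qed (simp add: ideal_gen.zero)

lemma ideal_power_add: "f \<in> ideal_power I k \<Longrightarrow> g \<in> ideal_power I k \<Longrightarrow> f + g \<in> ideal_power I k"
  by (cases k) (auto simp: ideal_prod_def intro: ideal_gen_add)

lemma ideal_power_mult_left: "f \<in> ideal_power I k \<Longrightarrow> a * f \<in> ideal_power I k"
  by (cases k) (auto simp: ideal_prod_def intro: ideal_gen_mult)

lemma ideal_power_0_mem: "0 \<in> ideal_power I k"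
  by (cases k) (auto simp: ideal_prod_def intro: ideal_gen.zero)

lemma ideal_power_sum: "(\<And>i. i \<in> A \<Longrightarrow> f i \<in> ideal_power I k) \<Longrightarrow> sum f A \<in> ideal_power I k"
  by (induction A rule: infinite_finite_induct) (auto intro: ideal_power_add ideal_power_0_mem)

lemma ideal_power_Suc_mult: "f \<in> ideal_power I k \<Longrightarrow> g \<in> I \<Longrightarrow> f * g \<in> ideal_power I (Suc k)"
  by (auto simp: ideal_prod_def intro: ideal_gen_superset)

lemma ideal_power_mult_power:
  "f \<in> ideal_power I k \<Longrightarrow> g \<in> I \<Longrightarrow> f * g ^ n \<in> ideal_power I (k + n)"
proof (induction n)
  case (Suc n)
  then show ?case
    using ideal_power_Suc_mult[of "f * g ^ n" I "k + n" g] by (simp add: mult.assoc mult.commute[of g])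
qed simp

lemma ideal_power_Suc_subset: "ideal_power I (Suc k) \<subseteq> ideal_power I k"
proof
  fix f assume "f \<in> ideal_power I (Suc k)"
  then show "f \<in> ideal_power I k"
    unfolding ideal_power.simps ideal_prod_def
  proof (induction f rule: ideal_gen.induct)
    case (step s f r)
    then obtain a b where "s = b * a" "a \<in> ideal_power I k"
      by (auto simp: mult.commute)
    then show ?case
      using step by (auto intro: ideal_power_add ideal_power_mult_left)
  qed (rule ideal_power_0_mem)
qed

lemma ideal_power_antimono: "j \<le> k \<Longrightarrow> ideal_power I k \<subseteq> ideal_power I j"
  by (rule lift_Suc_antimono_le[of "ideal_power I"]) (auto intro: ideal_power_Suc_subset[THEN subsetD])

section \<open>Linear forms and projective frames\<close>

definition linear_form :: "'a::comm_ring_1 pt \<Rightarrow> 'a poly3" where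
  "linear_form L = const3 (fst L) * X3 + const3 (fst (snd L)) * Y3 + const3 (snd (snd L)) * Z3"

lemma homogeneous_linear_form [simp]: "homogeneous (linear_form L) 1"
  unfolding linear_form_def
  by (intro homogeneous_add homogeneous_const_mult) (auto simp: X3_def Y3_def Z3_def intro!: homogeneous_single)

lemma lookup_linear_form:
  "Poly_Mapping.lookup (linear_form L) (1,0,0) = fst L"
  "Poly_Mapping.lookup (linear_form L) (0,1,0) = fst (snd L)"
  "Poly_Mapping.lookup (linear_form L) (0,0,1) = snd (snd L)"
  by (simp_all add: linear_form_def X3_def Y3_def Z3_def const3_mult_single lookup_add lookup_single when_def)

lemma linear_form_eq_0_iff [simp]: "linear_form L = 0 \<longleftrightarrow> L = (0,0,0)"
proof
  assume "linear_form L = 0"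
  then show "L = (0,0,0)"
    using lookup_linear_form[of L] by (metis lookup_zero prod.collapse)
qed (simp add: linear_form_def)

lemma peval_linear_form [simp]: "peval (linear_form L) P = lin L P"
  by (simp add: linear_form_def lin_def peval.hom_add peval.hom_mult)

lemma mdeg_eq_1: "mdeg m = 1 \<longleftrightarrow> m = (1,0,0) \<or> m = (0,1,0) \<or> m = (0,0,1)"
  by (cases m) (auto simp: mdeg_def)

lemma homogeneous_1E:
  fixes F :: "'a::comm_ring_1 poly3"
  assumes "homogeneous F 1"
  obtains L where "F = linear_form L"
proof -
  let ?L = "(Poly_Mapping.lookup F (1,0,0), Poly_Mapping.lookup F (0,1,0), Poly_Mapping.lookup F (0,0,1))"
  have "F = linear_form ?L"
  proof (rule poly_mapping_eqI)
    fix m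
    show "Poly_Mapping.lookup F m = Poly_Mapping.lookup (linear_form ?L) m"
    proof (cases "mdeg m = 1")
      case True
      then show ?thesis
        unfolding mdeg_eq_1 by (auto simp only: lookup_linear_form fst_conv snd_conv)
    next
      case False
      then have "m \<notin> Poly_Mapping.keys F" "m \<notin> Poly_Mapping.keys (linear_form ?L)"
        using assms homogeneous_linear_form[of ?L] unfolding homogeneous_def by blast+
      then show ?thesis by (simp add: in_keys_iff)
    qed
  qed
  then show thesis by (rule that)
qed

section \<open>Cross products: joins of points, meets of lines, and dual bases\<close>

definition cross :: "'a::comm_ring_1 pt \<Rightarrow> 'a pt \<Rightarrow> 'a pt" where
  "cross P Q = (fst (snd P) * snd (snd Q) - snd (snd P) * fst (snd Q),
                snd (snd P) * fst Q - fst P * snd (snd Q),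
                fst P * fst (snd Q) - fst (snd P) * fst Q)"

lemma lin_cross [simp]: "lin (cross P Q) P = 0" "lin (cross P Q) Q = 0"
  by (simp_all add: lin_def cross_def algebra_simps)

text \<open>The linear forms \<open>A\<close>, \<open>B\<close>, \<open>W\<close> are dual to the basis \<open>U\<close>, \<open>V\<close>, \<open>P\<close>, so that in the new
  coordinates \<open>P\<close> becomes \<open>(0:0:1)\<close>.\<close>

locale frame =
  fixes P U V A B W :: "'a::field pt"
  assumes dual: "lin A U = 1" "lin A V = 0" "lin A P = 0"
    "lin B U = 0" "lin B V = 1" "lin B P = 0"
    "lin W U = 0" "lin W V = 0" "lin W P = 1"
  and expand: "fst Q = lin A Q * fst U + lin B Q * fst V + lin W Q * fst P"
    "fst (snd Q) = lin A Q * fst (snd U) + lin B Q * fst (snd V) + lin W Q * fst (snd P)"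
    "snd (snd Q) = lin A Q * snd (snd U) + lin B Q * snd (snd V) + lin W Q * snd (snd P)"

text \<open>Cramer's rule: \<open>lin (cross P U) V\<close> is the determinant of the three vectors,
  and the pairwise cross products divided by it form the dual basis.\<close>

lemma frame_of_det:
  fixes P U V :: "'a::field pt"
  assumes d: "lin (cross P U) V = d" "d \<noteq> 0"
  defines "s \<equiv> (\<lambda>L::'a pt. (fst L / d, fst (snd L) / d, snd (snd L) / d))"
  shows "frame P U V (s (cross V P)) (s (cross P U)) (s (cross U V))"
proof -
  obtain p0 p1 p2 where P: "P = (p0,p1,p2)" by (cases P)
  obtain u0 u1 u2 where U: "U = (u0,u1,u2)" by (cases U)
  obtain v0 v1 v2 where V: "V = (v0,v1,v2)" by (cases V)
  have lins: "lin (s L) Q = lin L Q / d" for L Q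
    by (simp add: s_def lin_def add_divide_distrib)
  have dd: "d = (p1*u2-p2*u1)*v0 + (p2*u0-p0*u2)*v1 + (p0*u1-p1*u0)*v2"
    using d(1) by (simp add: P U V lin_def cross_def)
  show ?thesis
  proof
    fix Q :: "'a pt"
    obtain q0 q1 q2 where Q: "Q = (q0,q1,q2)" by (cases Q)
    \<comment> \<open>Clearing the denominator \<open>d\<close> turns each coordinate of the
      expansion into a polynomial identity.\<close>
    have "a = x / d * a1 + y / d * a2 + z / d * a3" if "d * a = x * a1 + y * a2 + z * a3" for a x y z a1 a2 a3
      using that d(2) by (simp add: divide_simps) (simp add: algebra_simps)
    note * = this
    show "fst Q = lin (s (cross V P)) Q * fst U + lin (s (cross P U)) Q * fst V + lin (s (cross U V)) Q * fst P"
      unfolding lins by (rule *) (simp add: dd P U V Q cross_def lin_def algebra_simps)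
    show "fst (snd Q) = lin (s (cross V P)) Q * fst (snd U) + lin (s (cross P U)) Q * fst (snd V) + lin (s (cross U V)) Q * fst (snd P)"
      unfolding lins by (rule *) (simp add: dd P U V Q cross_def lin_def algebra_simps)
    show "snd (snd Q) = lin (s (cross V P)) Q * snd (snd U) + lin (s (cross P U)) Q * snd (snd V) + lin (s (cross U V)) Q * snd (snd P)"
      unfolding lins by (rule *) (simp add: dd P U V Q cross_def lin_def algebra_simps)
  next
    have one: "lin (s (cross V P)) U = 1 \<longleftrightarrow> lin (cross V P) U = d"
      "lin (s (cross P U)) V = 1 \<longleftrightarrow> lin (cross P U) V = d"
      "lin (s (cross U V)) P = 1 \<longleftrightarrow> lin (cross U V) P = d"
      using d(2) by (auto simp: lins)
    show "lin (s (cross V P)) U = 1" "lin (s (cross P U)) V = 1" "lin (s (cross U V)) P = 1"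
      unfolding one by (simp_all add: dd P U V cross_def lin_def algebra_simps)
  qed (simp_all add: lins)
qed

lemma ex_lin_nonzero:
  fixes L :: "'a::field pt"
  assumes "L \<noteq> (0,0,0)"
  obtains V where "lin L V \<noteq> 0"
proof -
  have "lin L (1,0,0) \<noteq> 0 \<or> lin L (0,1,0) \<noteq> 0 \<or> lin L (0,0,1) \<noteq> 0"
    using assms by (cases L) (auto simp: lin_def)
  then show thesis using that by blast
qed

text \<open>Here the second basis vector can be prescribed as well, so that in frame coordinates
  \<open>U\<close> is \<open>(1:0:0)\<close> and \<open>P\<close> is \<open>(0:0:1)\<close>.\<close>

lemma ex_frame2:
  fixes P U :: "'a::field pt"
  assumes "cross P U \<noteq> (0,0,0)"
  obtains V A B W where "frame P U V A B W"
proof -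
  obtain V where "lin (cross P U) V \<noteq> 0" using ex_lin_nonzero[OF assms] by blast
  from frame_of_det[OF refl this] that show thesis by blast
qed

lemma ex_frame:
  fixes P :: "'a::field pt"
  assumes "P \<noteq> (0,0,0)"
  obtains U V A B W where "frame P U V A B W"
proof -
  have "cross P (1,0,0) \<noteq> (0,0,0) \<or> cross P (0,1,0) \<noteq> (0,0,0)"
    using assms by (cases P) (auto simp: cross_def)
  then show thesis using ex_frame2 that by metis
qed

text \<open>The scalar is the quotient of the coordinates at a position where \<open>P\<close> is
  nonzero; it is nonzero because otherwise all of \<open>Q\<close> would vanish.\<close>

lemma cross_eq_0_imp_proportional:
  fixes P Q :: "'a::field pt"
  assumes "cross P Q = (0,0,0)" "P \<noteq> (0,0,0)" "Q \<noteq> (0,0,0)"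
  shows "proportional P Q"
proof -
  obtain p0 p1 p2 where P: "P = (p0,p1,p2)" by (cases P)
  obtain q0 q1 q2 where Q: "Q = (q0,q1,q2)" by (cases Q)
  have eq: "p1 * q2 = p2 * q1" "p2 * q0 = p0 * q2" "p0 * q1 = p1 * q0"
    using assms(1) by (auto simp: cross_def P Q)
  consider "p0 \<noteq> 0" | "p1 \<noteq> 0" | "p2 \<noteq> 0" using assms(2) P by auto
  then show ?thesis
  proof cases
    case 1
    then show ?thesis
      unfolding proportional_def using eq assms(3)
      by (intro exI[of _ "q0 / p0"]) (auto simp: P Q field_simps)
  next
    case 2
    then show ?thesis
      unfolding proportional_def using eq assms(3)
      by (intro exI[of _ "q1 / p1"]) (auto simp: P Q field_simps)
  next
    case 3
    then show ?thesis
      unfolding proportional_def using eq assms(3)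
      by (intro exI[of _ "q2 / p2"]) (auto simp: P Q field_simps)
  qed
qed

section \<open>Coordinate change between the standard coordinates and a frame\<close>

context frame begin

text \<open>The variables are replaced by the coordinates of a general vector
  \<open>x U + y V + z P\<close>, so the coefficients of the result describe the form relative to
  the basis. The inverse \<open>from_frame\<close> inserts the dual linear forms.\<close>

definition to_frame :: "'a poly3 \<Rightarrow> 'a poly3" where
  "to_frame = eval3 const3 (linear_form (fst U, fst V, fst P))
     (linear_form (fst (snd U), fst (snd V), fst (snd P))) (linear_form (snd (snd U), snd (snd V), snd (snd P)))"

definition from_frame :: "'a poly3 \<Rightarrow> 'a poly3" where
  "from_frame = eval3 const3 (linear_form A) (linear_form B) (linear_form W)"

sublocale to_frame: comm_ring_hom to_frame
  unfolding to_frame_def by (rule eval3_hom) unfold_locales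

sublocale from_frame: comm_ring_hom from_frame
  unfolding from_frame_def by (rule eval3_hom) unfold_locales

lemmas to_frame_simps [simp] =
  eval3_const3[OF const3.comm_ring_hom_axioms, of "linear_form (fst U, fst V, fst P)"
     "linear_form (fst (snd U), fst (snd V), fst (snd P))" "linear_form (snd (snd U), snd (snd V), snd (snd P))",
     folded to_frame_def]
  eval3_vars[OF const3.comm_ring_hom_axioms, of "linear_form (fst U, fst V, fst P)"
     "linear_form (fst (snd U), fst (snd V), fst (snd P))" "linear_form (snd (snd U), snd (snd V), snd (snd P))",
     folded to_frame_def]

lemmas from_frame_simps [simp] =
  eval3_const3[OF const3.comm_ring_hom_axioms, of "linear_form A" "linear_form B" "linear_form W", folded from_frame_def]
  eval3_vars[OF const3.comm_ring_hom_axioms, of "linear_form A" "linear_form B" "linear_form W", folded from_frame_def]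

lemma to_frame_linear_form: "to_frame (linear_form L) = linear_form (lin L U, lin L V, lin L P)"
  by (simp add: linear_form_def lin_def to_frame.hom_add to_frame.hom_mult const3.hom_add const3.hom_mult algebra_simps)

lemma to_from_frame [simp]: "to_frame (from_frame F) = F"
proof (rule poly3_hom_eqI[where f = "\<lambda>F. to_frame (from_frame F)" and g = "\<lambda>F. F"])
  show "comm_ring_hom (\<lambda>F. to_frame (from_frame F))"
    by unfold_locales (auto simp: from_frame.hom_add to_frame.hom_add from_frame.hom_mult to_frame.hom_mult)
qed (auto simp: ring_hom_id to_frame_linear_form dual, auto simp: linear_form_def)

lemma from_frame_linear_form:
  "from_frame (linear_form L) = const3 (fst L) * linear_form A + const3 (fst (snd L)) * linear_form B
     + const3 (snd (snd L)) * linear_form W"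
  by (simp add: linear_form_def[of L] from_frame.hom_add from_frame.hom_mult)

lemma from_to_frame [simp]: "from_frame (to_frame F) = F"
proof (rule poly3_hom_eqI[where f = "\<lambda>F. from_frame (to_frame F)" and g = "\<lambda>F. F"])
  show "comm_ring_hom (\<lambda>F. from_frame (to_frame F))"
    by unfold_locales (auto simp: from_frame.hom_add to_frame.hom_add from_frame.hom_mult to_frame.hom_mult)
  have c: "const3 a * linear_form A + const3 b * linear_form B + const3 c * linear_form W = 
     const3 (a * fst A + b * fst B + c * fst W) * X3
     + const3 (a * fst (snd A) + b * fst (snd B) + c * fst (snd W)) * Y3
     + const3 (a * snd (snd A) + b * snd (snd B) + c * snd (snd W)) * Z3" for a b c
    by (simp add: linear_form_def const3.hom_add const3.hom_mult algebra_simps)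
  \<comment> \<open>Applied to the three unit vectors, \<open>expand\<close> gives the coefficients
    of the three variables.\<close>
  show "from_frame (to_frame X3) = X3"
    using expand(1)[of "(1,0,0)"] expand(1)[of "(0,1,0)"] expand(1)[of "(0,0,1)"]
    by (simp only: to_frame_simps from_frame_linear_form fst_conv snd_conv c) (simp add: lin_def mult.commute)
  show "from_frame (to_frame Y3) = Y3"
    using expand(2)[of "(1,0,0)"] expand(2)[of "(0,1,0)"] expand(2)[of "(0,0,1)"]
    by (simp only: to_frame_simps from_frame_linear_form fst_conv snd_conv c) (simp add: lin_def mult.commute)
  show "from_frame (to_frame Z3) = Z3"
    using expand(3)[of "(1,0,0)"] expand(3)[of "(0,1,0)"] expand(3)[of "(0,0,1)"]
    by (simp only: to_frame_simps from_frame_linear_form fst_conv snd_conv c) (simp add: lin_def mult.commute)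
qed (auto simp: ring_hom_id)

lemma to_frame_eq_0_iff [simp]: "to_frame F = 0 \<longleftrightarrow> F = 0"
  by (metis from_to_frame from_frame.hom_zero to_frame.hom_zero)

end

lemma eval3_homogeneous:
  fixes F :: "'a::comm_ring_1 poly3"
  assumes "homogeneous F n" "homogeneous x 1" "homogeneous y 1" "homogeneous z 1"
  shows "homogeneous (eval3 const3 x y z F) n"
  unfolding eval3_def
proof (intro homogeneous_sum homogeneous_const_mult)
  fix m assume "m \<in> Poly_Mapping.keys F"
  then have "mdeg m = n" using assms(1) by (auto simp: homogeneous_def)
  moreover have "homogeneous (mono_eval x y z m) (fst m * 1 + fst (snd m) * 1 + snd (snd m) * 1)"
    unfolding mono_eval_def by (intro homogeneous_mult homogeneous_power assms)
  ultimately show "homogeneous (mono_eval x y z m) n" by (simp add: mdeg_def)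
qed

context frame begin

lemma homogeneous_to_frame: "homogeneous F n \<Longrightarrow> homogeneous (to_frame F) n"
  unfolding to_frame_def by (intro eval3_homogeneous homogeneous_linear_form)

lemma homogeneous_from_frame: "homogeneous F n \<Longrightarrow> homogeneous (from_frame F) n"
  unfolding from_frame_def by (intro eval3_homogeneous homogeneous_linear_form)

lemma peval_to_frame:
  "peval (to_frame F) (a,b,c) = peval F (a * fst U + b * fst V + c * fst P,
     a * fst (snd U) + b * fst (snd V) + c * fst (snd P), a * snd (snd U) + b * snd (snd V) + c * snd (snd P))"
proof (rule poly3_hom_eqI[where f = "\<lambda>F. peval (to_frame F) (a,b,c)"])
  show "comm_ring_hom (\<lambda>F. peval (to_frame F) (a,b,c))"
    by unfold_locales (auto simp: peval.hom_add to_frame.hom_add peval.hom_mult to_frame.hom_mult)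
  show "comm_ring_hom (\<lambda>F. peval F (a * fst U + b * fst V + c * fst P,
     a * fst (snd U) + b * fst (snd V) + c * fst (snd P), a * snd (snd U) + b * snd (snd V) + c * snd (snd P)))"
    by (rule peval.comm_ring_hom_axioms)
qed (auto simp: lin_def algebra_simps)

end

section \<open>Multiplicities\<close>

text \<open>In frame coordinates, \<open>I(P)\<^bsup>k\<^esup>\<close> is spanned by the monomials of degree at least \<open>k\<close> in the first
  two variables.\<close>

definition vorder :: "nat \<times> nat \<times> nat \<Rightarrow> nat" where
  "vorder m = fst m + fst (snd m)"

definition vanishes :: "nat \<Rightarrow> 'a::zero poly3 \<Rightarrow> bool" where
  "vanishes k F \<longleftrightarrow> (\<forall>m\<in>Poly_Mapping.keys F. k \<le> vorder m)"

lemma vorder_add [simp]: "vorder (m + m') = vorder m + vorder m'"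
  by (simp add: vorder_def)

lemma vanishes_add:
  fixes F G :: "'a::comm_ring_1 poly3"
  shows "vanishes k F \<Longrightarrow> vanishes k G \<Longrightarrow> vanishes k (F + G)"
  using Poly_Mapping.keys_add[of F G] by (auto simp: vanishes_def)

lemma vanishes_mult:
  fixes F G :: "'a::comm_ring_1 poly3"
  shows "vanishes k F \<Longrightarrow> vanishes l G \<Longrightarrow> vanishes (k + l) (F * G)"
  unfolding vanishes_def
proof
  fix m assume *: "\<forall>m\<in>Poly_Mapping.keys F. k \<le> vorder m" "\<forall>m\<in>Poly_Mapping.keys G. l \<le> vorder m"
    and "m \<in> Poly_Mapping.keys (F * G)"
  then obtain a b where "m = a + b" "a \<in> Poly_Mapping.keys F" "b \<in> Poly_Mapping.keys G"
    using Poly_Mapping.keys_mult[of F G] by blast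
  then show "k + l \<le> vorder m" using * by (auto intro!: add_mono)
qed

lemma vanishes_0 [simp]: "vanishes 0 F" "vanishes k 0"
  by (simp_all add: vanishes_def)

text \<open>The condition on monomials becomes the order at 0 of a univariate polynomial over a
  domain, which is additive on products.\<close>

lemma vanishes_iff_order:
  fixes F :: "'a::idom poly3"
  assumes "F \<noteq> 0"
  shows "vanishes k F \<longleftrightarrow> k \<le> Polynomial.order 0 (weight_hom vorder F)"
proof -
  have "vanishes k F \<longleftrightarrow> (\<forall>n<k. Polynomial.coeff (weight_hom vorder F) n = 0)"
  proof safe
    fix n assume "vanishes k F" "n < k"
    then show "Polynomial.coeff (weight_hom vorder F) n = 0"
      by (intro poly_mapping_eqI) (simp add: lookup_coeff_weight_hom vanishes_def, metis in_keys_iff not_le)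
  next
    assume *: "\<forall>n<k. Polynomial.coeff (weight_hom vorder F) n = 0"
    show "vanishes k F"
      unfolding vanishes_def
    proof (intro ballI, rule ccontr)
      fix m assume "m \<in> Poly_Mapping.keys F" "\<not> k \<le> vorder m"
      then show False
        using * lookup_coeff_weight_hom[of vorder F "vorder m" m] by (simp add: in_keys_iff)
    qed
  qed
  also have "\<dots> \<longleftrightarrow> Polynomial.monom 1 k dvd weight_hom vorder F"
    by (simp add: monom_1_dvd_iff')
  also have "\<dots> \<longleftrightarrow> k \<le> Polynomial.order 0 (weight_hom vorder F)"
    using assms by (simp add: monom_1_dvd_iff)
  finally show ?thesis .
qed

lemma peval_Z_unit:
  fixes F :: "'a::comm_ring_1 poly3"
  assumes "homogeneous F n"
  shows "peval F (0,0,1) = Poly_Mapping.lookup F (0,0,n)"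
proof -
  have "peval F (0,0,1) = (\<Sum>m\<in>Poly_Mapping.keys F. if m = (0,0,n) then Poly_Mapping.lookup F m else 0)"
    unfolding peval_def
    by (rule sum.cong) (use assms in \<open>auto simp: homogeneous_def mdeg_def power_0_left\<close>)
  then show ?thesis by (auto simp: in_keys_iff)
qed

lemma peval_X_unit:
  fixes F :: "'a::comm_ring_1 poly3"
  assumes "homogeneous F n"
  shows "peval F (1,0,0) = Poly_Mapping.lookup F (n,0,0)"
proof -
  have "peval F (1,0,0) = (\<Sum>m\<in>Poly_Mapping.keys F. if m = (n,0,0) then Poly_Mapping.lookup F m else 0)"
    unfolding peval_def
    by (rule sum.cong) (use assms in \<open>auto simp: homogeneous_def mdeg_def power_0_left\<close>)
  then show ?thesis by (auto simp: in_keys_iff)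
qed

lemma linear_form_in_point_ideal: "lin L P = 0 \<Longrightarrow> linear_form L \<in> point_ideal P"
  unfolding point_ideal_def
  by (rule ideal_gen_superset) (auto intro!: exI[of _ 1] homogeneous_linear_form simp del: One_nat_def)

context frame begin

text \<open>A generator is a form vanishing at \<open>P\<close>, which is \<open>(0:0:1)\<close> in
  frame coordinates. So it lacks the pure power of the third variable, the only monomial of its
  degree with \<open>vorder\<close> 0.\<close>

lemma vanishes_to_frame_point_ideal:
  assumes "F \<in> point_ideal P"
  shows "vanishes 1 (to_frame F)"
  using assms unfolding point_ideal_def
proof (induction F rule: ideal_gen.induct)
  case (step s f r)
  then obtain n where n: "homogeneous s n" and s0: "peval s P = 0" by auto
  have hom: "homogeneous (to_frame s) n" using n by (rule homogeneous_to_frame)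
  have l0: "Poly_Mapping.lookup (to_frame s) (0,0,n) = 0"
    using peval_Z_unit[OF hom] peval_to_frame[of s 0 0 1] s0 by simp
  have "vanishes 1 (to_frame s)"
    unfolding vanishes_def
  proof
    fix m assume m: "m \<in> Poly_Mapping.keys (to_frame s)"
    then have "mdeg m = n" "m \<noteq> (0,0,n)" using hom l0 by (auto simp: homogeneous_def in_keys_iff)
    then show "1 \<le> vorder m" by (cases m) (auto simp: vorder_def mdeg_def)
  qed
  then have "vanishes (0 + 1) (to_frame r * to_frame s)"
    by (intro vanishes_mult) auto
  then show ?case
    using step by (simp add: to_frame.hom_add to_frame.hom_mult vanishes_add)
qed simp

text \<open>Orders add under products, which gives one direction by induction. Conversely,
  transporting the monomials back turns the first two variables into \<open>linear_form A\<close>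
  and \<open>linear_form B\<close>, which lie in the ideal of \<open>P\<close>.\<close>

lemma point_ideal_power_iff: "F \<in> ideal_power (point_ideal P) k \<longleftrightarrow> vanishes k (to_frame F)"
proof
  show "F \<in> ideal_power (point_ideal P) k \<Longrightarrow> vanishes k (to_frame F)"
  proof (induction k arbitrary: F)
    case (Suc k)
    from Suc.prems show ?case
      unfolding ideal_power.simps ideal_prod_def
    proof (induction F rule: ideal_gen.induct)
      case (step s f r)
      then obtain a b where s: "s = a * b" and a: "a \<in> ideal_power (point_ideal P) k" and b: "b \<in> point_ideal P"
        by auto
      have "vanishes (k + 1) (to_frame a * to_frame b)"
        by (intro vanishes_mult Suc.IH a vanishes_to_frame_point_ideal b)
      then have "vanishes (0 + Suc k) (to_frame r * to_frame s)"
        by (intro vanishes_mult) (auto simp: s to_frame.hom_mult)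
      then show ?case
        using step by (simp add: to_frame.hom_add to_frame.hom_mult vanishes_add)
    qed simp
  qed simp
next
  assume van: "vanishes k (to_frame F)"
  have "F = from_frame (to_frame F)" by simp
  also have "\<dots> = (\<Sum>m\<in>Poly_Mapping.keys (to_frame F).
      const3 (Poly_Mapping.lookup (to_frame F) m) * mono_eval (linear_form A) (linear_form B) (linear_form W) m)"
    by (simp add: from_frame_def eval3_def)
  also have "\<dots> \<in> ideal_power (point_ideal P) k"
  proof (intro ideal_power_sum ideal_power_mult_left)
    fix m assume "m \<in> Poly_Mapping.keys (to_frame F)"
    then have k: "k \<le> fst m + fst (snd m)" using van by (auto simp: vanishes_def vorder_def)
    have "linear_form A ^ fst m * linear_form B ^ fst (snd m)
        \<in> ideal_power (point_ideal P) (fst m + fst (snd m))"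
      using ideal_power_mult_power[of 1 "point_ideal P" 0 "linear_form A" "fst m"]
      by (intro ideal_power_mult_power) (simp_all add: linear_form_in_point_ideal dual)
    then have "linear_form W ^ snd (snd m) * (linear_form A ^ fst m * linear_form B ^ fst (snd m))
        \<in> ideal_power (point_ideal P) (fst m + fst (snd m))"
      using ideal_power_mult_left[of _ "point_ideal P" "fst m + fst (snd m)" "linear_form W ^ snd (snd m)"] by simp
    then show "mono_eval (linear_form A) (linear_form B) (linear_form W) m \<in> ideal_power (point_ideal P) k"
      using ideal_power_antimono[OF k] by (auto simp: mono_eval_def ac_simps)
  qed
  finally show "F \<in> ideal_power (point_ideal P) k" .
qed

end

text \<open>The multiplicity of the curve \<open>F = 0\<close> at \<open>P\<close>. The zero
  polynomial lies in every power, so no greatest exponent exists for it; hence the assumptions that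
  \<open>F\<close> is nonzero below.\<close>

definition mult_at :: "'a::field pt \<Rightarrow> 'a poly3 \<Rightarrow> nat" where
  "mult_at P F = (GREATEST k. F \<in> ideal_power (point_ideal P) k)"

context frame begin

lemma mult_at_eq_order:
  assumes "F \<noteq> 0"
  shows "mult_at P F = Polynomial.order 0 (weight_hom vorder (to_frame F))"
  unfolding mult_at_def by (rule Greatest_equality) (use assms in \<open>auto simp: point_ideal_power_iff vanishes_iff_order\<close>)

end

context
  fixes P :: "'a::field pt"
  assumes P: "P \<noteq> (0,0,0)"
begin

lemma point_ideal_power_iff_mult_at:
  assumes "F \<noteq> 0"
  shows "F \<in> ideal_power (point_ideal P) k \<longleftrightarrow> k \<le> mult_at P F"
proof -
  from P obtain U V A B W where "frame P U V A B W" by (rule ex_frame)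
  then interpret frame P U V A B W .
  show ?thesis
    using assms by (simp add: mult_at_eq_order point_ideal_power_iff vanishes_iff_order)
qed

text \<open>Multiplicity is a valuation because the order at 0 of univariate polynomials over a
  domain is one.\<close>

lemma mult_at_mult:
  assumes "F \<noteq> 0" "G \<noteq> 0"
  shows "mult_at P (F * G) = mult_at P F + mult_at P G"
proof -
  from P obtain U V A B W where "frame P U V A B W" by (rule ex_frame)
  then interpret frame P U V A B W .
  show ?thesis
    using assms by (simp add: mult_at_eq_order to_frame.hom_mult weight_hom_mult order_mult)
qed

lemma mult_at_le_degree:
  assumes "F \<noteq> 0" "homogeneous F n"
  shows "mult_at P F \<le> n"
proof -
  from P obtain U V A B W where "frame P U V A B W" by (rule ex_frame)
  then interpret frame P U V A B W .
  have "vanishes (mult_at P F) (to_frame F)"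
    using point_ideal_power_iff_mult_at[OF assms(1), of "mult_at P F"] by (simp add: point_ideal_power_iff)
  moreover have "to_frame F \<noteq> 0" using assms(1) by simp
  then obtain m where "m \<in> Poly_Mapping.keys (to_frame F)" by (metis all_not_in_conv keys_eq_empty)
  moreover have "homogeneous (to_frame F) n" using assms(2) by (rule homogeneous_to_frame)
  ultimately show ?thesis
    by (force simp: vanishes_def homogeneous_def vorder_def mdeg_def)
qed

lemma mult_at_linear_form:
  assumes "L \<noteq> (0,0,0)"
  shows "mult_at P (linear_form L) = (if lin L P = 0 then 1 else 0)"
proof -
  from P obtain U V A B W where "frame P U V A B W" by (rule ex_frame)
  then interpret frame P U V A B W .
  have nz: "linear_form L \<noteq> 0" using assms by simp
  have "mult_at P (linear_form L) \<le> 1"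
    by (rule mult_at_le_degree[OF nz homogeneous_linear_form])
  moreover have "1 \<le> mult_at P (linear_form L) \<longleftrightarrow> lin L P = 0"
  proof
    assume "1 \<le> mult_at P (linear_form L)"
    then have "vanishes 1 (to_frame (linear_form L))"
      using point_ideal_power_iff_mult_at[OF nz, of 1] point_ideal_power_iff[of "linear_form L" 1] by blast
    then have "(0,0,1) \<notin> Poly_Mapping.keys (linear_form (lin L U, lin L V, lin L P))"
      by (auto simp: to_frame_linear_form vanishes_def vorder_def)
    then show "lin L P = 0"
      using lookup_linear_form(3)[of "(lin L U, lin L V, lin L P)"] by (simp add: in_keys_iff)
  next
    assume "lin L P = 0"
    then have "1 * linear_form L \<in> ideal_power (point_ideal P) (Suc 0)"
      by (intro ideal_power_Suc_mult linear_form_in_point_ideal) simp_all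
    then show "1 \<le> mult_at P (linear_form L)"
      using point_ideal_power_iff_mult_at[OF nz, of 1] by simp
  qed
  ultimately show ?thesis by auto
qed

lemma mult_at_1 [simp]: "mult_at P 1 = 0"
  using mult_at_mult[of 1 1] by simp

lemma mult_at_power: "F \<noteq> 0 \<Longrightarrow> mult_at P (F ^ n) = n * mult_at P F"
  by (induction n) (simp_all add: mult_at_mult)

lemma mult_at_prod:
  "(\<And>i. i \<in> I \<Longrightarrow> f i \<noteq> 0) \<Longrightarrow> mult_at P (\<Prod>i\<in>I. f i) = (\<Sum>i\<in>I. mult_at P (f i))"
  by (induction I rule: infinite_finite_induct) (simp_all add: mult_at_mult)

end

lemma fat_ideal_iff:
  fixes Z :: "'a::field pt set"
  assumes "\<forall>P\<in>Z. P \<noteq> (0,0,0)" "F \<noteq> 0"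
  shows "F \<in> fat_ideal Z k \<longleftrightarrow> (\<forall>P\<in>Z. k \<le> mult_at P F)"
  using assms by (auto simp: fat_ideal_def point_ideal_power_iff_mult_at)

section \<open>Irreducible forms are prime\<close>

text \<open>The isomorphism with the iterated univariate ring, \<open>x0\<close> being the innermost
  variable. It carries unique factorization over to \<open>poly3\<close>.\<close>

definition to_iterated :: "'a::comm_ring_1 poly3 \<Rightarrow> 'a poly poly poly" where
  "to_iterated F = (\<Sum>m\<in>Poly_Mapping.keys F. Polynomial.monom (Polynomial.monom
     (Polynomial.monom (Poly_Mapping.lookup F m) (fst m)) (fst (snd m))) (snd (snd m)))"

lemma coeff_to_iterated:
  "Polynomial.coeff (Polynomial.coeff (Polynomial.coeff (to_iterated F) l) j) i = Poly_Mapping.lookup F (i,j,l)"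
proof -
  have "Polynomial.coeff (Polynomial.coeff (Polynomial.coeff (to_iterated F) l) j) i
     = (\<Sum>m\<in>Poly_Mapping.keys F. if m = (i,j,l) then Poly_Mapping.lookup F m else 0)"
    unfolding to_iterated_def coeff_sum by (rule sum.cong) auto
  then show ?thesis by (auto simp: in_keys_iff)
qed

lemma iterated_poly_eqI:
  "(\<And>i j l. Polynomial.coeff (Polynomial.coeff (Polynomial.coeff p l) j) i
     = Polynomial.coeff (Polynomial.coeff (Polynomial.coeff q l) j) i) \<Longrightarrow> p = q"
  by (intro poly_eqI) auto

lemma to_iterated_single:
  "to_iterated (Poly_Mapping.single m c)
     = Polynomial.monom (Polynomial.monom (Polynomial.monom c (fst m)) (fst (snd m))) (snd (snd m))"
  by (rule iterated_poly_eqI) (auto simp: coeff_to_iterated lookup_single when_def)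

lemma to_iterated_add: "to_iterated (F + G) = to_iterated F + to_iterated G"
  by (rule iterated_poly_eqI) (simp add: coeff_to_iterated lookup_add)

lemma to_iterated_mult: "to_iterated (F * G) = to_iterated F * to_iterated G"
proof (induction F rule: poly3_induct)
  case (monom m c)
  show ?case
    by (induction G rule: poly3_induct)
      (simp_all add: Poly_Mapping.mult_single to_iterated_single to_iterated_add mult_monom algebra_simps)
qed (simp add: to_iterated_add distrib_right)

lemma to_iterated_1: "to_iterated 1 = 1"
  using to_iterated_single[of 0 1] by (simp flip: Polynomial.monom_eq_1)

lemma inj_to_iterated: "inj to_iterated"
  by (rule injI, rule poly_mapping_eqI) (metis coeff_to_iterated prod.collapse)

lemma surj_to_iterated: "surj (to_iterated :: 'a::comm_ring_1 poly3 \<Rightarrow> _)"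
proof (unfold surj_def, rule allI)
  fix p :: "'a poly poly poly"
  let ?f = "\<lambda>(i,j,l). Polynomial.coeff (Polynomial.coeff (Polynomial.coeff p l) j) i"
  \<comment> \<open>The nested degrees bound the exponents, so the coefficient function has finite
    support and defines an element of \<open>poly3\<close>.\<close>
  have "{m. ?f m \<noteq> 0} \<subseteq> (\<lambda>(l,j,i). (i,j,l)) ` (SIGMA l:{..Polynomial.degree p}.
      SIGMA j:{..Polynomial.degree (Polynomial.coeff p l)}. {..Polynomial.degree (Polynomial.coeff (Polynomial.coeff p l) j)})"
  proof clarify
    fix i j l assume nz: "Polynomial.coeff (Polynomial.coeff (Polynomial.coeff p l) j) i \<noteq> 0"
    then have "i \<le> Polynomial.degree (Polynomial.coeff (Polynomial.coeff p l) j)" by (rule le_degree)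
    moreover have "j \<le> Polynomial.degree (Polynomial.coeff p l)" using nz by (intro le_degree) auto
    moreover have "l \<le> Polynomial.degree p" using nz by (intro le_degree) auto
    ultimately show "(i,j,l) \<in> (\<lambda>(l,j,i). (i,j,l)) ` (SIGMA l:{..Polynomial.degree p}.
      SIGMA j:{..Polynomial.degree (Polynomial.coeff p l)}. {..Polynomial.degree (Polynomial.coeff (Polynomial.coeff p l) j)})"
      by (intro image_eqI[of _ _ "(l,j,i)"]) auto
  qed
  then have fin: "finite {m. ?f m \<noteq> 0}" by (rule finite_subset) auto
  have "to_iterated (Abs_poly_mapping ?f) = p"
    by (rule iterated_poly_eqI) (simp add: coeff_to_iterated Abs_poly_mapping_inverse fin)
  then show "\<exists>F. p = to_iterated F" by metis
qed

lemma to_iterated_dvd_iff: "to_iterated F dvd to_iterated G \<longleftrightarrow> F dvd G"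
proof
  assume "to_iterated F dvd to_iterated G"
  then obtain q where "to_iterated G = to_iterated F * q" by (rule dvdE)
  moreover obtain H where "q = to_iterated H" using surj_to_iterated by (metis surjD)
  ultimately show "F dvd G"
    using inj_to_iterated by (metis dvd_triv_left injD to_iterated_mult)
qed (auto simp: to_iterated_mult elim!: dvdE)

text \<open>The isomorphism \<open>to_iterated\<close> preserves divisibility and units, and in the
  factorial iterated ring irreducible elements are prime.\<close>

lemma irreducible_imp_prime_poly3:
  fixes F :: "'a::field poly3"
  assumes "irreducible F"
  shows "prime_elem F"
proof -
  have [simp]: "to_iterated G = 0 \<longleftrightarrow> G = 0" for G :: "'a poly3"
    using inj_to_iterated to_iterated_add[of 0 0] by (metis add_cancel_right_right injD)
  have unit: "to_iterated G dvd 1 \<longleftrightarrow> G dvd 1" for G :: "'a poly3"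
    by (metis to_iterated_1 to_iterated_dvd_iff)
  have "irreducible (to_iterated F)"
  proof (rule irreducibleI)
    fix a b assume ab: "to_iterated F = a * b"
    obtain a' b' where "a = to_iterated a'" "b = to_iterated b'" using surj_to_iterated by (metis surjD)
    with ab have "F = a' * b'" using inj_to_iterated by (metis injD to_iterated_mult)
    with assms have "a' dvd 1 \<or> b' dvd 1" by (auto dest: irreducibleD)
    then show "a dvd 1 \<or> b dvd 1" by (simp add: \<open>a = _\<close> \<open>b = _\<close> unit)
  qed (use assms in \<open>auto simp: unit irreducible_def\<close>)
  then have *: "prime_elem (to_iterated F)" by simp
  show ?thesis
  proof (rule prime_elemI)
    fix a b assume "F dvd a * b"
    then have "to_iterated F dvd to_iterated a * to_iterated b"
      by (simp add: to_iterated_dvd_iff flip: to_iterated_mult)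
    then show "F dvd a \<or> F dvd b"
      using prime_elem_dvd_multD[OF *, of "to_iterated a" "to_iterated b"] by (simp add: to_iterated_dvd_iff)
  qed (use assms in \<open>auto simp: irreducible_def\<close>)
qed

section \<open>Factors of forms\<close>

lemma homogeneous_0E:
  fixes F :: "'a::comm_ring_1 poly3"
  assumes "homogeneous F 0"
  obtains c where "F = const3 c"
proof -
  have "F = const3 (Poly_Mapping.lookup F 0)"
  proof (rule poly_mapping_eqI)
    fix m
    show "Poly_Mapping.lookup F m = Poly_Mapping.lookup (const3 (Poly_Mapping.lookup F 0)) m"
    proof (cases "m = 0")
      case False
      then have "mdeg m \<noteq> 0" by (cases m) (auto simp: mdeg_def zero_prod_def)
      then have "m \<notin> Poly_Mapping.keys F" using assms by (auto simp: homogeneous_def)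
      with False show ?thesis by (simp add: const3_def lookup_single in_keys_iff)
    qed (simp add: const3_def)
  qed
  then show thesis by (rule that)
qed

lemma homogeneous_0_unit:
  fixes F :: "'a::field poly3"
  assumes "homogeneous F 0" "F \<noteq> 0"
  shows "F dvd 1"
proof -
  obtain c where c: "F = const3 c" using homogeneous_0E[OF assms(1)] by blast
  then have "1 = F * const3 (inverse c)"
    using assms(2) by (simp flip: const3.hom_mult)
  then show ?thesis by (metis dvd_triv_left)
qed

lemma homogeneous_factors:
  fixes F G :: "'a::idom poly3"
  assumes "homogeneous (F * G) n" "F * G \<noteq> 0"
  obtains k l where "homogeneous F k" "homogeneous G l" "k + l = n"
proof -
  obtain k where k: "homogeneous F k" using homogeneous_factor[OF assms] by blast
  obtain l where l: "homogeneous G l" using homogeneous_factor[of G F n] assms by (auto simp: mult.commute)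
  have "k + l = n" using homogeneous_unique[OF homogeneous_mult[OF k l] assms(1,2)] .
  with k l that show thesis by blast
qed

text \<open>In any factorization both factors are forms. By minimality one of them has degree 0 or
  the full degree \<open>n\<close>, so one factor is a nonzero constant.\<close>

lemma irreducible_if_no_homogeneous_factor:
  fixes F :: "'a::field poly3"
  assumes F: "homogeneous F n" "F \<noteq> 0" "n > 0"
    and min: "\<And>G k. G dvd F \<Longrightarrow> homogeneous G k \<Longrightarrow> k > 0 \<Longrightarrow> n \<le> k"
  shows "irreducible F"
proof (rule irreducibleI)
  show "\<not> F dvd 1"
  proof
    assume "F dvd 1"
    then obtain G where G: "F * G = 1" by (metis dvdE)
    then obtain k l where "homogeneous F k" "k + l = 0"
      using homogeneous_factors[of F G 0] by (metis homogeneous_1 one_neq_zero)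
    then show False using homogeneous_unique[OF F(1) _ F(2)] F(3) by auto
  qed
next
  fix a b assume ab: "F = a * b"
  then obtain k l where kl: "homogeneous a k" "homogeneous b l" "k + l = n"
    using homogeneous_factors[of a b n] F by metis
  have nz: "a \<noteq> 0" "b \<noteq> 0" using ab F(2) by auto
  have "k = 0 \<or> n \<le> k" using min[OF _ kl(1)] ab by auto
  then show "a dvd 1 \<or> b dvd 1"
    using kl homogeneous_0_unit nz by auto
qed (fact F(2))

section \<open>Linear systems\<close>

text \<open>Gaussian elimination, one equation and one unknown at a time.\<close>

lemma linear_system:
  fixes a :: "'i \<Rightarrow> 'j \<Rightarrow> 'a::field"
  assumes "finite J" "finite I" "card J < card I"
  shows "\<exists>c. (\<exists>i\<in>I. c i \<noteq> 0) \<and> (\<forall>j\<in>J. (\<Sum>i\<in>I. c i * a i j) = 0)"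
  using assms
proof (induction J arbitrary: I a rule: finite_induct)
  case empty
  then obtain i where "i \<in> I" by (metis card.empty ex_in_conv less_irrefl)
  then show ?case by (intro exI[of _ "\<lambda>_. 1"]) auto
next
  case (insert j J)
  show ?case
  proof (cases "\<forall>i\<in>I. a i j = 0")
    case True
    obtain c where "\<exists>i\<in>I. c i \<noteq> 0" "\<forall>j\<in>J. (\<Sum>i\<in>I. c i * a i j) = 0"
      using insert.IH[of I a] insert.prems insert.hyps by auto
    with True show ?thesis by (intro exI[of _ c]) auto
  next
    case False
    then obtain i0 where i0: "i0 \<in> I" "a i0 j \<noteq> 0" by blast
    define I' where "I' = I - {i0}"
    \<comment> \<open>Equation \<open>j\<close> is solved for the unknown \<open>i0\<close>, and the
      result is substituted into the remaining equations.\<close>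
    have "card J < card I'" using insert i0 by (simp add: I'_def)
    then obtain c where c: "\<exists>i\<in>I'. c i \<noteq> 0"
      "\<forall>l\<in>J. (\<Sum>i\<in>I'. c i * (a i l - a i j / a i0 j * a i0 l)) = 0"
      using insert.IH[of I' "\<lambda>i l. a i l - a i j / a i0 j * a i0 l"] insert.prems by (auto simp: I'_def)
    define s where "s = (\<Sum>i\<in>I'. c i * a i j)"
    define c' where "c' = c(i0 := - s / a i0 j)"
    have split: "(\<Sum>i\<in>I. c' i * a i l) = - s / a i0 j * a i0 l + (\<Sum>i\<in>I'. c i * a i l)" for l
    proof -
      have "(\<Sum>i\<in>I. c' i * a i l) = c' i0 * a i0 l + (\<Sum>i\<in>I'. c' i * a i l)"
        unfolding I'_def using insert.prems i0 by (subst sum.remove[of I i0]) auto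
      also have "(\<Sum>i\<in>I'. c' i * a i l) = (\<Sum>i\<in>I'. c i * a i l)"
        by (rule sum.cong) (auto simp: c'_def I'_def)
      finally show ?thesis by (simp add: c'_def)
    qed
    have "(\<Sum>i\<in>I. c' i * a i l) = 0" if "l \<in> J" for l
    proof -
      have "0 = (\<Sum>i\<in>I'. c i * a i l - c i * a i j * (a i0 l / a i0 j))"
        using c(2) that by (simp add: right_diff_distrib mult.assoc)
      also have "\<dots> = (\<Sum>i\<in>I'. c i * a i l) - s * (a i0 l / a i0 j)"
        unfolding s_def sum_distrib_right by (rule sum_subtractf)
      finally show ?thesis unfolding split by simp
    qed
    moreover have "(\<Sum>i\<in>I. c' i * a i j) = 0"
      unfolding split using i0 by (simp flip: s_def)
    moreover have "\<exists>i\<in>I. c' i \<noteq> 0" using c(1) by (auto simp: c'_def I'_def)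
    ultimately show ?thesis by (intro exI[of _ c']) auto
  qed
qed

text \<open>Linear dependence on the family \<open>c\<close> of unknowns, for scalars here and for
  polynomials in \<open>linear_poly_in\<close>. Linearity of a composite system can then be checked
  by closure rules, without writing down its matrix.\<close>

definition linear_in :: "'i set \<Rightarrow> (('i \<Rightarrow> 'a::comm_ring_1) \<Rightarrow> 'a) \<Rightarrow> bool" where
  "linear_in I f \<longleftrightarrow> (\<exists>a. \<forall>c. f c = (\<Sum>i\<in>I. c i * a i))"

definition linear_poly_in :: "'i set \<Rightarrow> (('i \<Rightarrow> 'a::comm_ring_1) \<Rightarrow> 'a poly3) \<Rightarrow> bool" where
  "linear_poly_in I X \<longleftrightarrow> (\<exists>a. \<forall>c. X c = (\<Sum>i\<in>I. const3 (c i) * a i))"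

definition functional3 :: "('a::comm_ring_1 poly3 \<Rightarrow> 'a) \<Rightarrow> bool" where
  "functional3 f \<longleftrightarrow> (\<forall>F G. f (F + G) = f F + f G) \<and> (\<forall>c F. f (const3 c * F) = c * f F)"

lemma linear_system_solvable:
  fixes f :: "'j \<Rightarrow> ('i \<Rightarrow> 'a::field) \<Rightarrow> 'a"
  assumes "finite J" "finite I" "card J < card I" and lin: "\<And>j. j \<in> J \<Longrightarrow> linear_in I (f j)"
  shows "\<exists>c. (\<exists>i\<in>I. c i \<noteq> 0) \<and> (\<forall>j\<in>J. f j c = 0)"
proof -
  have "\<forall>j\<in>J. \<exists>a. \<forall>c. f j c = (\<Sum>i\<in>I. c i * a i)"
    using lin by (simp add: linear_in_def)
  then obtain a where "\<forall>j\<in>J. \<forall>c. f j c = (\<Sum>i\<in>I. c i * a j i)"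
    by metis
  with linear_system[OF assms(1-3), of "\<lambda>i j. a j i"] show ?thesis by auto
qed

lemma linear_poly_in_add:
  "linear_poly_in I X \<Longrightarrow> linear_poly_in I Y \<Longrightarrow> linear_poly_in I (\<lambda>c. X c + Y c)"
  unfolding linear_poly_in_def
proof (elim exE)
  fix a b assume "\<forall>c. X c = (\<Sum>i\<in>I. const3 (c i) * a i)" "\<forall>c. Y c = (\<Sum>i\<in>I. const3 (c i) * b i)"
  then show "\<exists>a. \<forall>c. X c + Y c = (\<Sum>i\<in>I. const3 (c i) * a i)"
    by (intro exI[of _ "\<lambda>i. a i + b i"]) (simp add: distrib_left sum.distrib)
qed

lemma linear_poly_in_mult: "linear_poly_in I X \<Longrightarrow> linear_poly_in I (\<lambda>c. X c * F)"
  unfolding linear_poly_in_def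
proof (elim exE)
  fix a assume "\<forall>c. X c = (\<Sum>i\<in>I. const3 (c i) * a i)"
  then show "\<exists>a. \<forall>c. X c * F = (\<Sum>i\<in>I. const3 (c i) * a i)"
    by (intro exI[of _ "\<lambda>i. a i * F"]) (simp add: sum_distrib_right mult.assoc)
qed

text \<open>The map \<open>g\<close> embeds the labels of one block of unknowns into the full index
  set \<open>I\<close>; the sum is regrouped along the fibres of \<open>g\<close>.\<close>

lemma linear_poly_in_sum:
  assumes "finite I" "finite J" "g ` J \<subseteq> I"
  shows "linear_poly_in I (\<lambda>c. \<Sum>j\<in>J. const3 (c (g j)) * b j)"
  unfolding linear_poly_in_def
proof (intro exI allI)
  fix c
  have "(\<Sum>i\<in>I. const3 (c i) * (\<Sum>j | j \<in> J \<and> g j = i. b j))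
      = (\<Sum>i\<in>I. \<Sum>j | j \<in> J \<and> g j = i. const3 (c (g j)) * b j)"
    by (intro sum.cong refl) (simp add: sum_distrib_left)
  also have "\<dots> = (\<Sum>j\<in>J. const3 (c (g j)) * b j)"
    using assms by (intro sum.group)
  finally show "(\<Sum>j\<in>J. const3 (c (g j)) * b j) = (\<Sum>i\<in>I. const3 (c i) * (\<Sum>j | j \<in> J \<and> g j = i. b j))" ..
qed

lemma functional3_0: "functional3 f \<Longrightarrow> f 0 = 0"
  unfolding functional3_def by (metis add_cancel_right_right)

lemma functional3_sum: "functional3 f \<Longrightarrow> f (\<Sum>i\<in>I. g i) = (\<Sum>i\<in>I. f (g i))"
  by (induction I rule: infinite_finite_induct) (auto simp: functional3_0, auto simp: functional3_def)

lemma linear_in_functional3: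
  assumes "functional3 f" "linear_poly_in I X"
  shows "linear_in I (\<lambda>c. f (X c))"
proof -
  obtain a where a: "\<forall>c. X c = (\<Sum>i\<in>I. const3 (c i) * a i)"
    using assms(2) by (auto simp: linear_poly_in_def)
  have "f (X c) = (\<Sum>i\<in>I. c i * f (a i))" for c
    using assms(1) by (simp add: a functional3_sum) (simp add: functional3_def)
  then show ?thesis unfolding linear_in_def by (intro exI[of _ "\<lambda>i. f (a i)"]) simp
qed

lemma lookup_const3_mult: "Poly_Mapping.lookup (const3 c * F) m = c * Poly_Mapping.lookup F m"
  by (induction F rule: poly3_induct)
    (auto simp: const3_mult_single lookup_single when_def lookup_add distrib_left)

lemma functional3_lookup: "functional3 (\<lambda>F. Poly_Mapping.lookup F m)"
  by (simp add: functional3_def lookup_add lookup_const3_mult)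

section \<open>Counting monomials and conditions\<close>

definition monomials :: "nat \<Rightarrow> (nat \<times> nat \<times> nat) set" where
  "monomials n = {m. mdeg m = n}"

text \<open>The exponents of the first two frame variables in monomials of order below
  \<open>k\<close>. Each pair is one linear condition for multiplicity \<open>k\<close>, so there
  are \<open>k (k + 1) / 2\<close> conditions.\<close>

definition small_pairs :: "nat \<Rightarrow> (nat \<times> nat) set" where
  "small_pairs k = {(i,j). i + j < k}"

lemma finite_small_pairs [simp]: "finite (small_pairs k)"
  by (rule finite_subset[of _ "{..k} \<times> {..k}"]) (auto simp: small_pairs_def)

text \<open>Going from \<open>k\<close> to \<open>k + 1\<close> adds the diagonal
  \<open>i + j = k\<close>, which has \<open>k + 1\<close> elements.\<close>

lemma card_small_pairs: "2 * card (small_pairs k) = k * (k + 1)"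
proof (induction k)
  case (Suc k)
  have eq: "small_pairs (Suc k) = small_pairs k \<union> (\<lambda>i. (i, k - i)) ` {..k}"
    by (auto simp: small_pairs_def image_iff)
  have "card ((\<lambda>i. (i, k - i)) ` {..k}) = k + 1"
    by (subst card_image) (auto simp: inj_on_def)
  moreover have "small_pairs k \<inter> (\<lambda>i. (i, k - i)) ` {..k} = {}"
    by (auto simp: small_pairs_def)
  ultimately have "card (small_pairs (Suc k)) = card (small_pairs k) + (k + 1)"
    unfolding eq by (subst card_Un_disjoint) auto
  with Suc show ?case by (simp add: algebra_simps)
qed (simp add: small_pairs_def)

lemma monomials_eq_image: "monomials n = (\<lambda>(i,j). (i, j, n - i - j)) ` small_pairs (Suc n)"
  by (force simp: monomials_def small_pairs_def mdeg_def image_iff)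

lemma finite_monomials [simp]: "finite (monomials n)"
  by (simp add: monomials_eq_image)

lemma card_monomials: "2 * card (monomials n) = (n + 1) * (n + 2)"
proof -
  have "card (monomials n) = card (small_pairs (Suc n))"
    unfolding monomials_eq_image by (rule card_image) (auto simp: inj_on_def)
  then show ?thesis using card_small_pairs[of "Suc n"] by simp
qed

lemma homogeneous_lookup_eq_0: "homogeneous F n \<Longrightarrow> m \<notin> monomials n \<Longrightarrow> Poly_Mapping.lookup F m = 0"
  by (auto simp: homogeneous_def monomials_def in_keys_iff)

definition form_of :: "nat \<Rightarrow> (nat \<times> nat \<times> nat \<Rightarrow> 'a::comm_ring_1) \<Rightarrow> 'a poly3" where
  "form_of n c = (\<Sum>m\<in>monomials n. const3 (c m) * Poly_Mapping.single m 1)"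

lemma homogeneous_form_of: "homogeneous (form_of n c) n"
  unfolding form_of_def
  by (intro homogeneous_sum homogeneous_const_mult homogeneous_single) (simp add: monomials_def)

lemma lookup_form_of: "m \<in> monomials n \<Longrightarrow> Poly_Mapping.lookup (form_of n c) m = c m"
  unfolding form_of_def lookup_sum lookup_const3_mult by (simp add: lookup_single when_def if_distrib cong: if_cong)

text \<open>In degree \<open>n\<close> the third exponent is determined by the other two. When
  \<open>i + j > n\<close>, truncated subtraction yields a monomial of the wrong degree and the
  condition is void.\<close>

lemma (in frame) homogeneous_point_power_iff:
  assumes "homogeneous F n"
  shows "F \<in> ideal_power (point_ideal P) k
    \<longleftrightarrow> (\<forall>(i,j)\<in>small_pairs k. Poly_Mapping.lookup (to_frame F) (i, j, n - i - j) = 0)"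
  unfolding point_ideal_power_iff
proof
  assume "vanishes k (to_frame F)"
  then show "\<forall>(i,j)\<in>small_pairs k. Poly_Mapping.lookup (to_frame F) (i, j, n - i - j) = 0"
    by (force simp: vanishes_def vorder_def small_pairs_def in_keys_iff)
next
  assume *: "\<forall>(i,j)\<in>small_pairs k. Poly_Mapping.lookup (to_frame F) (i, j, n - i - j) = 0"
  show "vanishes k (to_frame F)"
    unfolding vanishes_def
  proof (intro ballI, rule ccontr)
    fix m assume m: "m \<in> Poly_Mapping.keys (to_frame F)" "\<not> k \<le> vorder m"
    obtain i j l where ijl: "m = (i,j,l)" by (cases m)
    have "mdeg m = n" using m homogeneous_to_frame[OF assms] by (auto simp: homogeneous_def)
    then have "l = n - i - j" by (simp add: ijl mdeg_def)
    with * m show False by (auto simp: ijl vorder_def small_pairs_def in_keys_iff)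
  qed
qed

text \<open>The frame coefficients as abstract functionals, chosen once per point for all
  \<open>n\<close> and \<open>k\<close>. This permits conditions from different frames within a
  single linear system.\<close>

definition point_functionals :: "'a::field pt \<Rightarrow> (nat \<times> nat \<times> nat \<Rightarrow> 'a poly3 \<Rightarrow> 'a) \<Rightarrow> bool" where
  "point_functionals P \<phi> \<longleftrightarrow> (\<forall>m. functional3 (\<phi> m)) \<and> (\<forall>F n k. homogeneous F n \<longrightarrow>
     F \<in> ideal_power (point_ideal P) k \<longleftrightarrow> (\<forall>(i,j)\<in>small_pairs k. \<phi> (i, j, n - i - j) F = 0))"

lemma ex_point_functionals:
  fixes P :: "'a::field pt"
  assumes "P \<noteq> (0,0,0)"
  shows "\<exists>\<phi>. point_functionals P \<phi>"
proof -
  from assms obtain U V A B W where "frame P U V A B W" by (rule ex_frame)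
  then interpret frame P U V A B W .
  show ?thesis
    unfolding point_functionals_def
  proof (intro exI conjI allI impI)
    fix m
    show "functional3 ((\<lambda>m F. Poly_Mapping.lookup (to_frame F) m) m)"
      by (simp add: functional3_def to_frame.hom_add to_frame.hom_mult lookup_add lookup_const3_mult)
  qed (simp add: homogeneous_point_power_iff)
qed

text \<open>Dimension count: a form of degree \<open>n\<close> has more coefficients than the points
  impose linear conditions.\<close>

lemma ex_form_with_multiplicities:
  fixes Z :: "'a::field pt set"
  assumes Z: "finite Z" "\<forall>P\<in>Z. P \<noteq> (0,0,0)"
    and card: "(\<Sum>P\<in>Z. card (small_pairs (s P))) < card (monomials n)"
  obtains F where "F \<noteq> 0" "homogeneous F n" "\<forall>P\<in>Z. F \<in> ideal_power (point_ideal P) (s P)"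
proof -
  obtain \<phi> where \<phi>: "\<And>P. P \<in> Z \<Longrightarrow> point_functionals P (\<phi> P)"
    using bchoice[of Z point_functionals] ex_point_functionals Z(2) by blast
  let ?J = "SIGMA P:Z. small_pairs (s P)"
  let ?f = "\<lambda>(P,i,j) c. \<phi> P (i, j, n - i - j) (form_of n c)"
  have lin: "linear_poly_in (monomials n) (form_of n)"
    using linear_poly_in_sum[of "monomials n" "monomials n" "\<lambda>m. m" "\<lambda>m. Poly_Mapping.single m 1"]
    by (simp add: form_of_def[abs_def])
  have "linear_in (monomials n) (?f x)" if "x \<in> ?J" for x
  proof -
    obtain P i j where x: "x = (P,i,j)" "P \<in> Z" using \<open>x \<in> ?J\<close> by auto
    then have "functional3 (\<phi> P (i, j, n - i - j))" using \<phi>[of P] by (simp only: point_functionals_def)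
    from linear_in_functional3[OF this lin] show ?thesis by (simp add: x)
  qed
  then have "\<exists>c. (\<exists>m\<in>monomials n. c m \<noteq> 0) \<and> (\<forall>x\<in>?J. ?f x c = 0)"
    using Z(1) card by (intro linear_system_solvable) auto
  then obtain c where c: "\<exists>m\<in>monomials n. c m \<noteq> 0" "\<And>x. x \<in> ?J \<Longrightarrow> ?f x c = 0"
    by blast
  show thesis
  proof (rule that[of "form_of n c"])
    show "form_of n c \<noteq> 0" using c(1) lookup_form_of by (metis lookup_zero)
    show "homogeneous (form_of n c) n" by (rule homogeneous_form_of)
    show "\<forall>P\<in>Z. form_of n c \<in> ideal_power (point_ideal P) (s P)"
    proof
      fix P assume P: "P \<in> Z"
      have "\<forall>(i,j)\<in>small_pairs (s P). \<phi> P (i, j, n - i - j) (form_of n c) = 0"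
      proof clarify
        fix i j assume "(i,j) \<in> small_pairs (s P)"
        then show "\<phi> P (i, j, n - i - j) (form_of n c) = 0" using c(2)[of "(P,i,j)"] P by simp
      qed
      with \<phi>[OF P] homogeneous_form_of[of n c] show "form_of n c \<in> ideal_power (point_ideal P) (s P)"
        unfolding point_functionals_def by blast
    qed
  qed
qed

section \<open>Bezout's inequality with multiplicities\<close>

lemma proportional_sym: "proportional P Q \<Longrightarrow> proportional Q P"
  unfolding proportional_def
proof (elim exE conjE)
  fix c assume "c \<noteq> 0" "Q = (c * fst P, c * fst (snd P), c * snd (snd P))"
  then show "\<exists>c. c \<noteq> 0 \<and> P = (c * fst Q, c * fst (snd Q), c * snd (snd Q))"
    by (intro exI[of _ "inverse c"]) (auto simp: prod_eq_iff)
qed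

text \<open>The line joining \<open>Q\<close> to a point \<open>V\<close> off the line
  \<open>P Q\<close> misses \<open>P\<close>, since the determinant of the three points is invariant
  under cyclic permutation.\<close>

lemma ex_separating_line:
  fixes P Q :: "'a::field pt"
  assumes "P \<noteq> (0,0,0)" "Q \<noteq> (0,0,0)" "\<not> proportional P Q"
  obtains L where "L \<noteq> (0,0,0)" "lin L Q = 0" "lin L P \<noteq> 0"
proof -
  have "cross P Q \<noteq> (0,0,0)" using cross_eq_0_imp_proportional assms by blast
  then obtain V where "lin (cross P Q) V \<noteq> 0" using ex_lin_nonzero by blast
  moreover have "lin (cross Q V) P = lin (cross P Q) V" "lin (cross Q V) Q = 0"
    by (simp_all add: lin_def cross_def algebra_simps)
  moreover from calculation have "cross Q V \<noteq> (0,0,0)" by (auto simp: lin_def)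
  ultimately show thesis using that[of "cross Q V"] by simp
qed

lemma point_ideal_power_mult:
  fixes P :: "'a::field pt"
  assumes "P \<noteq> (0,0,0)" "F \<in> ideal_power (point_ideal P) k" "G \<in> ideal_power (point_ideal P) l"
  shows "F * G \<in> ideal_power (point_ideal P) (k + l)"
proof -
  from assms(1) obtain U V A B W where "frame P U V A B W" by (rule ex_frame)
  then interpret frame P U V A B W .
  show ?thesis
    using assms(2,3) by (simp add: point_ideal_power_iff to_frame.hom_mult vanishes_mult)
qed

lemma homogeneous_linear_form_power: "homogeneous (linear_form L ^ k) k"
  using homogeneous_power[OF homogeneous_linear_form, of L k] by simp

text \<open>For large degree, the conditions imposed by the fat points are independent.\<close>

lemma separated_forms:
  fixes Z :: "'a::field pt set"
  assumes Z: "finite Z" "\<forall>P\<in>Z. P \<noteq> (0,0,0)" "\<forall>P\<in>Z. \<forall>Q\<in>Z. proportional P Q \<longrightarrow> P = Q"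
    and P: "P \<in> Z" and n: "(\<Sum>Q\<in>Z. N Q) \<le> n"
  shows "\<exists>g. (\<forall>x\<in>small_pairs (N P). homogeneous (g x) n \<and> (\<forall>Q\<in>Z - {P}. g x \<in> ideal_power (point_ideal Q) (N Q)))
    \<and> (\<forall>c. (\<Sum>x\<in>small_pairs (N P). const3 (c x) * g x) \<in> ideal_power (point_ideal P) (N P)
         \<longrightarrow> (\<forall>x\<in>small_pairs (N P). c x = 0))"
proof -
  have P0: "P \<noteq> (0,0,0)" using P Z by blast
  then obtain U V A B W where "frame P U V A B W" by (rule ex_frame)
  then interpret frame P U V A B W .
  have "\<forall>Q\<in>Z - {P}. \<exists>L. L \<noteq> (0,0,0) \<and> lin L Q = 0 \<and> lin L P \<noteq> 0"
  proof
    fix Q assume "Q \<in> Z - {P}"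
    then have "Q \<noteq> (0,0,0)" "\<not> proportional P Q" using Z P by auto
    from ex_separating_line[OF P0 this] show "\<exists>L. L \<noteq> (0,0,0) \<and> lin L Q = 0 \<and> lin L P \<noteq> 0" by blast
  qed
  from bchoice[OF this] obtain \<Lambda> where \<Lambda>: "\<And>Q. Q \<in> Z - {P} \<Longrightarrow> \<Lambda> Q \<noteq> (0,0,0) \<and> lin (\<Lambda> Q) Q = 0 \<and> lin (\<Lambda> Q) P \<noteq> 0"
    by blast
  \<comment> \<open>Powers of lines through the other points, each missing \<open>P\<close>:
    \<open>R\<close> has multiplicity at least \<open>N Q\<close> at each other \<open>Q\<close> and
    multiplicity 0 at \<open>P\<close>.\<close>
  define R where "R = (\<Prod>Q\<in>Z - {P}. linear_form (\<Lambda> Q) ^ N Q)"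
  define w where "w = (\<Sum>Q\<in>Z - {P}. N Q)"
  have sum: "(\<Sum>Q\<in>Z. N Q) = N P + w" unfolding w_def using Z(1) P by (rule sum.remove)
  have R0: "R \<noteq> 0" unfolding R_def using Z(1) \<Lambda> by auto
  have homR: "homogeneous R w"
    unfolding R_def w_def by (intro homogeneous_prod homogeneous_linear_form_power)
  have multR: "mult_at Q R = (\<Sum>S\<in>Z - {P}. N S * (if lin (\<Lambda> S) Q = 0 then 1 else 0))" if "Q \<in> Z" for Q
  proof -
    have "Q \<noteq> (0,0,0)" using Z that by blast
    then show ?thesis
      unfolding R_def using \<Lambda> by (subst mult_at_prod) (auto simp: mult_at_power mult_at_linear_form)
  qed
  \<comment> \<open>Since \<open>N P + w \<le> n\<close> and \<open>i + j < N P\<close>, the third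
    exponent is a true difference and \<open>g (i,j)\<close> has degree \<open>n\<close>.\<close>
  define g where "g = (\<lambda>(i,j). R * from_frame (Poly_Mapping.single (i, j, n - w - i - j) 1))"
  show ?thesis
  proof (intro exI[of _ g] conjI ballI allI impI)
    fix x assume "x \<in> small_pairs (N P)"
    then obtain i j where x: "x = (i,j)" "i + j < N P" by (auto simp: small_pairs_def)
    have "homogeneous (from_frame (Poly_Mapping.single (i, j, n - w - i - j) (1::'a))) (n - w)"
      using n sum x by (intro homogeneous_from_frame homogeneous_single) simp
    then have "homogeneous (g x) (w + (n - w))"
      unfolding g_def x by (simp add: homogeneous_mult homR)
    then show "homogeneous (g x) n" using n sum by simp
    fix Q assume Q: "Q \<in> Z - {P}"
    then have "N Q * (if lin (\<Lambda> Q) Q = 0 then 1 else 0) \<le> mult_at Q R"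
      using Q Z(1) member_le_sum[of Q "Z - {P}" "\<lambda>S. N S * (if lin (\<Lambda> S) Q = 0 then 1 else 0)"]
      by (simp add: multR)
    then have "R \<in> ideal_power (point_ideal Q) (N Q)"
      using point_ideal_power_iff_mult_at[OF _ R0] \<Lambda>[OF Q] Z(2) Q by auto
    then show "g x \<in> ideal_power (point_ideal Q) (N Q)"
      unfolding g_def x by (simp add: ideal_power_mult_left mult.commute[of R])
  next
    fix c x assume c: "(\<Sum>x\<in>small_pairs (N P). const3 (c x) * g x) \<in> ideal_power (point_ideal P) (N P)"
      and x: "x \<in> small_pairs (N P)"
    \<comment> \<open>The monomials of \<open>H\<close> all have order below \<open>N P\<close>. As
      \<open>R\<close> has multiplicity 0 at \<open>P\<close>, the membership forces
      \<open>H\<close> to have order at least \<open>N P\<close>, and so every coefficient is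
      zero.\<close>
    define H where "H = (\<Sum>(i,j)\<in>small_pairs (N P). Poly_Mapping.single (i, j, n - w - i - j) (c (i,j)))"
    have "(\<Sum>x\<in>small_pairs (N P). const3 (c x) * g x) = R * from_frame H"
      unfolding H_def from_frame.hom_sum sum_distrib_left
    proof (rule sum.cong[OF refl])
      fix x :: "nat \<times> nat"
      obtain i j where x: "x = (i,j)" by (cases x)
      have "from_frame (Poly_Mapping.single (i, j, n - w - i - j) (c (i,j)))
          = from_frame (const3 (c (i,j)) * Poly_Mapping.single (i, j, n - w - i - j) 1)"
        by (simp add: const3_mult_single)
      also have "\<dots> = const3 (c (i,j)) * from_frame (Poly_Mapping.single (i, j, n - w - i - j) 1)"
        by (simp add: from_frame.hom_mult)
      finally show "const3 (c x) * g x = R * from_frame (case x of (i,j) \<Rightarrow> Poly_Mapping.single (i, j, n - w - i - j) (c (i,j)))"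
        by (simp add: g_def x mult.left_commute)
    qed
    with c have mem: "R * from_frame H \<in> ideal_power (point_ideal P) (N P)" by simp
    have multRP: "mult_at P R = 0" using multR[OF P] \<Lambda> by simp
    have "vanishes (N P) H"
    proof (cases "H = 0")
      case False
      then have FH: "from_frame H \<noteq> 0" by (metis to_from_frame to_frame.hom_zero)
      have "N P \<le> mult_at P (R * from_frame H)"
        using mem point_ideal_power_iff_mult_at[OF P0, of "R * from_frame H"] R0 FH by simp
      then have "N P \<le> mult_at P (from_frame H)"
        using mult_at_mult[OF P0 R0 FH] multRP by simp
      then show ?thesis
        using point_ideal_power_iff_mult_at[OF P0 FH] point_ideal_power_iff[of "from_frame H"] by simp
    qed simp
    obtain i j where ij: "x = (i,j)" "i + j < N P" using x by (auto simp: small_pairs_def)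
    have "Poly_Mapping.lookup H (i, j, n - w - i - j) = (\<Sum>y\<in>small_pairs (N P). if y = x then c x else 0)"
      unfolding H_def lookup_sum by (rule sum.cong) (auto simp: lookup_single when_def ij split: if_splits)
    then have "Poly_Mapping.lookup H (i, j, n - w - i - j) = c x" using x by simp
    moreover have "(i, j, n - w - i - j) \<notin> Poly_Mapping.keys H"
      using \<open>vanishes (N P) H\<close> ij(2) by (force simp: vanishes_def vorder_def)
    ultimately show "c x = 0" by (simp add: in_keys_iff)
  qed
qed

text \<open>The leading monomials multiply without cancellation, because only the pair of maxima
  attains the sum of the maxima.\<close>

lemma lookup_mult_Max:
  fixes F G :: "'a::idom poly3"
  assumes "F \<noteq> 0" "G \<noteq> 0"
  shows "Poly_Mapping.lookup (F * G) (Max (Poly_Mapping.keys F) + Max (Poly_Mapping.keys G)) \<noteq> 0"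
proof -
  let ?a = "Max (Poly_Mapping.keys F)" and ?b = "Max (Poly_Mapping.keys G)"
  have ne: "Poly_Mapping.keys F \<noteq> {}" "Poly_Mapping.keys G \<noteq> {}" using assms by auto
  have mem: "?a \<in> Poly_Mapping.keys F" "?b \<in> Poly_Mapping.keys G" using ne by simp_all
  have "F * G = (\<Sum>a\<in>Poly_Mapping.keys F. \<Sum>b\<in>Poly_Mapping.keys G.
      Poly_Mapping.single (a + b) (Poly_Mapping.lookup F a * Poly_Mapping.lookup G b))"
    by (subst (1) sum_single_lookup[of F, symmetric], subst (1) sum_single_lookup[of G, symmetric])
      (simp add: sum_product Poly_Mapping.mult_single)
  then have "Poly_Mapping.lookup (F * G) (?a + ?b) = (\<Sum>a\<in>Poly_Mapping.keys F. \<Sum>b\<in>Poly_Mapping.keys G.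
      Poly_Mapping.lookup (Poly_Mapping.single (a + b) (Poly_Mapping.lookup F a * Poly_Mapping.lookup G b)) (?a + ?b))"
    by (simp only: lookup_sum)
  also have "\<dots> = (\<Sum>a\<in>Poly_Mapping.keys F. \<Sum>b\<in>Poly_Mapping.keys G.
      if a = ?a \<and> b = ?b then Poly_Mapping.lookup F a * Poly_Mapping.lookup G b else 0)"
  proof (intro sum.cong refl)
    fix a b assume ab: "a \<in> Poly_Mapping.keys F" "b \<in> Poly_Mapping.keys G"
    then have le: "a \<le> ?a" "b \<le> ?b" by simp_all
    have "a = ?a \<and> b = ?b" if "a + b = ?a + ?b"
      using le that by (metis add_less_le_mono add_le_less_mono order_le_less order_less_irrefl)
    then show "Poly_Mapping.lookup (Poly_Mapping.single (a + b) (Poly_Mapping.lookup F a * Poly_Mapping.lookup G b)) (?a + ?b)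
       = (if a = ?a \<and> b = ?b then Poly_Mapping.lookup F a * Poly_Mapping.lookup G b else 0)"
      by (auto simp: lookup_single when_def)
  qed
  also have "\<dots> = (\<Sum>a\<in>Poly_Mapping.keys F. if a = ?a then Poly_Mapping.lookup F a * Poly_Mapping.lookup G ?b else 0)"
    using mem by (intro sum.cong refl) auto
  also have "\<dots> = Poly_Mapping.lookup F ?a * Poly_Mapping.lookup G ?b"
    using mem by simp
  finally show ?thesis using mem by (simp add: in_keys_iff)
qed

lemma ideal_power_diff:
  assumes "f + g \<in> ideal_power I k" "g \<in> ideal_power I k"
  shows "f \<in> ideal_power I k"
  using ideal_power_add[OF assms(1) ideal_power_mult_left[OF assms(2), of "- 1"]] by simp

text \<open>The left side counts the equations and the right side the unknowns of the system in
  \<open>bezout_inequality\<close>. The cross terms are \<open>m P n P\<close> for the conditions at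
  \<open>P\<close> and \<open>e f\<close> for the monomials.\<close>

lemma sum_less_imp_card_less:
  fixes m n :: "'p \<Rightarrow> nat"
  assumes "e * f < (\<Sum>P\<in>Z. m P * n P)" "N = e + f + t"
  shows "card (monomials N) + ((\<Sum>P\<in>Z. card (small_pairs (n P))) + ((\<Sum>P\<in>Z. card (small_pairs (m P))) + card (monomials t)))
    < card (monomials (f + t)) + card (monomials (e + t)) + (\<Sum>P\<in>Z. card (small_pairs (m P + n P)))"
proof -
  have "card (small_pairs (m P + n P)) = card (small_pairs (m P)) + card (small_pairs (n P)) + m P * n P" for P
    using card_small_pairs[of "m P + n P"] card_small_pairs[of "m P"] card_small_pairs[of "n P"]
    by (simp add: algebra_simps)
  then have "(\<Sum>P\<in>Z. card (small_pairs (m P + n P))) = (\<Sum>P\<in>Z. card (small_pairs (m P)))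
      + (\<Sum>P\<in>Z. card (small_pairs (n P))) + (\<Sum>P\<in>Z. m P * n P)"
    by (simp add: sum.distrib)
  moreover have "card (monomials N) + card (monomials t) = card (monomials (f + t)) + card (monomials (e + t)) + e * f"
    using card_monomials[of N] card_monomials[of t] card_monomials[of "f + t"] card_monomials[of "e + t"] assms(2)
    by (simp add: algebra_simps)
  ultimately show ?thesis using assms(1) by linarith
qed

text \<open>For large \<open>N\<close> the forms \<open>A C + B D\<close> of degree \<open>N\<close> have codimension \<open>e f\<close>, since \<open>C\<close> and
  \<open>D\<close> have only the trivial syzygy. Modulo \<open>\<Inter>P. I(P)\<^bsup>m P + n P\<^esup>\<close>, the form \<open>A\<close> matters only modulo
  \<open>I(P)\<^bsup>n P\<^esup>\<close> and \<open>B\<close> only modulo \<open>I(P)\<^bsup>m P\<^esup>\<close>, which forces codimension at least \<open>\<Sum>P. m P n P\<close>.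
  Both counts are packed into a single homogeneous linear system, which would be
  underdetermined if the inequality failed but has only the trivial solution.\<close>

lemma bezout_inequality:
  fixes C D :: "'a::field poly3"
  assumes Z: "finite Z" "\<forall>P\<in>Z. P \<noteq> (0,0,0)" "\<forall>P\<in>Z. \<forall>Q\<in>Z. proportional P Q \<longrightarrow> P = Q"
    and C: "prime_elem C" "homogeneous C e"
    and D: "D \<noteq> 0" "homogeneous D f" "\<not> C dvd D"
    and m: "\<And>P. P \<in> Z \<Longrightarrow> C \<in> ideal_power (point_ideal P) (m P)"
    and n: "\<And>P. P \<in> Z \<Longrightarrow> D \<in> ideal_power (point_ideal P) (n P)"
  shows "(\<Sum>P\<in>Z. m P * n P) \<le> e * f"
proof (rule ccontr)
  assume "\<not> ?thesis"
  then have less: "e * f < (\<Sum>P\<in>Z. m P * n P)" by simp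
  have C0: "C \<noteq> 0" using C(1) by auto
  \<comment> \<open>With this \<open>t\<close> the degree \<open>N\<close> is large enough for
    \<open>separated_forms\<close> with multiplicities \<open>m P + n P\<close>.\<close>
  define t where "t = (\<Sum>P\<in>Z. m P + n P)"
  define N where "N = e + f + t"
  obtain \<phi> where \<phi>: "\<And>P. P \<in> Z \<Longrightarrow> point_functionals P (\<phi> P)"
    using bchoice[of Z point_functionals] ex_point_functionals Z(2) by blast
  define sep where "sep P g \<longleftrightarrow> (\<forall>x\<in>small_pairs (m P + n P). homogeneous (g x) N
      \<and> (\<forall>Q\<in>Z - {P}. g x \<in> ideal_power (point_ideal Q) (m Q + n Q)))
    \<and> (\<forall>c. (\<Sum>x\<in>small_pairs (m P + n P). const3 (c x) * g x) \<in> ideal_power (point_ideal P) (m P + n P)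
         \<longrightarrow> (\<forall>x\<in>small_pairs (m P + n P). c x = 0))" for P :: "'a pt" and g
  have "\<forall>P\<in>Z. \<exists>g. sep P g"
  proof
    fix P assume "P \<in> Z"
    then show "\<exists>g. sep P g"
      unfolding sep_def using separated_forms[OF Z, of P "\<lambda>P. m P + n P" N] by (simp add: N_def t_def)
  qed
  from bchoice[OF this] obtain g where g: "\<And>P. P \<in> Z \<Longrightarrow> sep P (g P)" by blast

  define K where "K = (SIGMA P:Z. small_pairs (m P + n P))"
  \<comment> \<open>Unknowns: the coefficients of \<open>A\<close>, those of \<open>B\<close>, and
    those of the combination \<open>G\<close> of separated forms.\<close>
  define I where "I = (monomials (f + t) <+> monomials (e + t)) <+> K"
  \<comment> \<open>Equations: \<open>A C + B D + G = 0\<close> in degree \<open>N\<close>;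
    multiplicity \<open>n P\<close> of \<open>A\<close>; multiplicity \<open>m P\<close> of
    \<open>B\<close>; and one normalization for each monomial of degree \<open>t\<close>.\<close>
  define J where "J = monomials N <+> ((SIGMA P:Z. small_pairs (n P)) <+> ((SIGMA P:Z. small_pairs (m P)) <+> monomials t))"
  have finK: "finite K" unfolding K_def using Z(1) by auto
  have finI: "finite I" unfolding I_def using finK by simp
  have finJ: "finite J" unfolding J_def using Z(1) by simp
  have cardI: "card I = card (monomials (f + t)) + card (monomials (e + t)) + (\<Sum>P\<in>Z. card (small_pairs (m P + n P)))"
    unfolding I_def using finK Z(1) by (simp add: card_Plus K_def)
  have cardJ: "card J = card (monomials N) + ((\<Sum>P\<in>Z. card (small_pairs (n P)))
      + ((\<Sum>P\<in>Z. card (small_pairs (m P))) + card (monomials t)))"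
    unfolding J_def using Z(1) by (simp add: card_Plus)
  have card: "card J < card I"
    unfolding cardI cardJ by (rule sum_less_imp_card_less[OF less N_def])

  define A where "A c = form_of (f + t) (\<lambda>k. c (Inl (Inl k)))"
    for c :: "((nat \<times> nat \<times> nat) + (nat \<times> nat \<times> nat)) + ('a pt \<times> nat \<times> nat) \<Rightarrow> 'a"
  define B where "B c = form_of (e + t) (\<lambda>k. c (Inl (Inr k)))"
    for c :: "((nat \<times> nat \<times> nat) + (nat \<times> nat \<times> nat)) + ('a pt \<times> nat \<times> nat) \<Rightarrow> 'a"
  define G where "G c = (\<Sum>x\<in>K. const3 (c (Inr x)) * g (fst x) (snd x))"
    for c :: "((nat \<times> nat \<times> nat) + (nat \<times> nat \<times> nat)) + ('a pt \<times> nat \<times> nat) \<Rightarrow> 'a"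
  have linA: "linear_poly_in I A"
    unfolding A_def form_of_def using finI by (intro linear_poly_in_sum) (auto simp: I_def)
  have linB: "linear_poly_in I B"
    unfolding B_def form_of_def using finI by (intro linear_poly_in_sum) (auto simp: I_def)
  have linG: "linear_poly_in I G"
    unfolding G_def using finI finK by (intro linear_poly_in_sum) (auto simp: I_def)
  have homA: "homogeneous (A c) (f + t)" for c unfolding A_def by (rule homogeneous_form_of)
  have homB: "homogeneous (B c) (e + t)" for c unfolding B_def by (rule homogeneous_form_of)
  have homG: "homogeneous (G c) N" for c
    unfolding G_def using g by (intro homogeneous_sum homogeneous_const_mult) (auto simp: K_def sep_def)

  \<comment> \<open>The last block makes the coefficients of \<open>A\<close> vanish at the leading
    monomial of \<open>D\<close> times any monomial of degree \<open>t\<close>. It excludes nonzero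
    multiples \<open>A = - T D\<close>, \<open>B = C T\<close> of the trivial syzygy.\<close>
  define E where "E j c = (case j of Inl k \<Rightarrow> Poly_Mapping.lookup (A c * C + B c * D + G c) k
    | Inr (Inl (P,i,j)) \<Rightarrow> \<phi> P (i, j, f + t - i - j) (A c)
    | Inr (Inr (Inl (P,i,j))) \<Rightarrow> \<phi> P (i, j, e + t - i - j) (B c)
    | Inr (Inr (Inr k)) \<Rightarrow> Poly_Mapping.lookup (A c) (Max (Poly_Mapping.keys D) + k))" for j c
  have "linear_in I (E j)" if j: "j \<in> J" for j
  proof -
    consider k where "j = Inl k" | P a b where "P \<in> Z" "j = Inr (Inl (P,a,b))"
      | P a b where "P \<in> Z" "j = Inr (Inr (Inl (P,a,b)))" | k where "j = Inr (Inr (Inr k))"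
      using j by (auto simp: J_def)
    then show ?thesis
    proof cases
      case 1
      have "linear_poly_in I (\<lambda>c. A c * C + B c * D + G c)"
        by (intro linear_poly_in_add linear_poly_in_mult linA linB linG)
      from linear_in_functional3[OF functional3_lookup this] show ?thesis by (simp add: 1 E_def[abs_def])
    next
      case 2
      then have "functional3 (\<phi> P (a, b, f + t - a - b))" using \<phi> by (auto simp: point_functionals_def)
      from linear_in_functional3[OF this linA] show ?thesis by (simp add: 2 E_def[abs_def])
    next
      case 3
      then have "functional3 (\<phi> P (a, b, e + t - a - b))" using \<phi> by (auto simp: point_functionals_def)
      from linear_in_functional3[OF this linB] show ?thesis by (simp add: 3 E_def[abs_def])
    next
      case 4
      from linear_in_functional3[OF functional3_lookup linA] show ?thesis by (simp add: 4 E_def[abs_def])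
    qed
  qed
  then have "\<exists>c. (\<exists>i\<in>I. c i \<noteq> 0) \<and> (\<forall>j\<in>J. E j c = 0)"
    by (rule linear_system_solvable[OF finJ finI card])
  then obtain c where c: "\<exists>i\<in>I. c i \<noteq> 0" and sol: "\<And>j. j \<in> J \<Longrightarrow> E j c = 0"
    by blast

  have "A c * C + B c * D + G c = 0"
  proof (rule poly_mapping_eqI)
    fix k
    have "homogeneous (A c * C + B c * D + G c) N"
      using homogeneous_mult[OF homA C(2)] homogeneous_mult[OF homB D(2)] homG
      by (intro homogeneous_add) (simp_all add: N_def add_ac)
    then show "Poly_Mapping.lookup (A c * C + B c * D + G c) k = Poly_Mapping.lookup 0 k"
      using sol[of "Inl k"] homogeneous_lookup_eq_0[of "A c * C + B c * D + G c" N k]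
      by (cases "k \<in> monomials N") (auto simp: E_def J_def)
  qed
  then have G_eq: "G c = - (A c * C + B c * D)" by (rule minus_unique[symmetric])
  have memA: "A c \<in> ideal_power (point_ideal P) (n P)" if P: "P \<in> Z" for P
  proof -
    have "\<forall>(i,j)\<in>small_pairs (n P). \<phi> P (i, j, f + t - i - j) (A c) = 0"
    proof clarify
      fix i j assume "(i,j) \<in> small_pairs (n P)"
      then show "\<phi> P (i, j, f + t - i - j) (A c) = 0"
        using sol[of "Inr (Inl (P,i,j))"] P by (simp add: E_def J_def Plus_def)
    qed
    with \<phi>[OF P] homA show ?thesis unfolding point_functionals_def by blast
  qed
  have memB: "B c \<in> ideal_power (point_ideal P) (m P)" if P: "P \<in> Z" for P
  proof -
    have "\<forall>(i,j)\<in>small_pairs (m P). \<phi> P (i, j, e + t - i - j) (B c) = 0"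
    proof clarify
      fix i j assume "(i,j) \<in> small_pairs (m P)"
      then show "\<phi> P (i, j, e + t - i - j) (B c) = 0"
        using sol[of "Inr (Inr (Inl (P,i,j)))"] P by (simp add: E_def J_def Plus_def)
    qed
    with \<phi>[OF P] homB show ?thesis unfolding point_functionals_def by blast
  qed
  have memG: "G c \<in> ideal_power (point_ideal P) (m P + n P)" if P: "P \<in> Z" for P
  proof -
    have P0: "P \<noteq> (0,0,0)" using Z P by blast
    have "A c * C + B c * D \<in> ideal_power (point_ideal P) (m P + n P)"
      using point_ideal_power_mult[OF P0 memA[OF P] m[OF P]] point_ideal_power_mult[OF P0 memB[OF P] n[OF P]]
      by (intro ideal_power_add) (simp_all add: add.commute)
    from ideal_power_mult_left[OF this, of "- 1"] show ?thesis unfolding G_eq by simp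
  qed
  \<comment> \<open>The parts of \<open>G\<close> belonging to other points have multiplicity at
    least \<open>m P + n P\<close> at \<open>P\<close>. Hence so has the part of \<open>P\<close>,
    and the independence of its separated forms gives zero coefficients.\<close>
  have cG: "c (Inr (P,x)) = 0" if P: "P \<in> Z" and x: "x \<in> small_pairs (m P + n P)" for P x
  proof -
    define part where "part Q = (\<Sum>x\<in>small_pairs (m Q + n Q). const3 (c (Inr (Q,x))) * g Q x)" for Q
    have "G c = (\<Sum>Q\<in>Z. part Q)"
      unfolding G_def K_def part_def using Z(1) by (subst sum.Sigma) (auto simp: case_prod_unfold)
    also have "\<dots> = part P + (\<Sum>Q\<in>Z - {P}. part Q)" using Z(1) P by (rule sum.remove)
    finally have "part P + (\<Sum>Q\<in>Z - {P}. part Q) \<in> ideal_power (point_ideal P) (m P + n P)"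
      using memG[OF P] by simp
    moreover have "(\<Sum>Q\<in>Z - {P}. part Q) \<in> ideal_power (point_ideal P) (m P + n P)"
      unfolding part_def
    proof (intro ideal_power_sum ideal_power_mult_left)
      fix Q x assume "Q \<in> Z - {P}" "x \<in> small_pairs (m Q + n Q)"
      then show "g Q x \<in> ideal_power (point_ideal P) (m P + n P)"
        using g[of Q] P unfolding sep_def by blast
    qed
    ultimately have "part P \<in> ideal_power (point_ideal P) (m P + n P)" by (rule ideal_power_diff)
    moreover have "\<forall>x\<in>small_pairs (m P + n P). d x = 0"
      if "(\<Sum>x\<in>small_pairs (m P + n P). const3 (d x) * g P x) \<in> ideal_power (point_ideal P) (m P + n P)" for d
      using g[OF P] that unfolding sep_def by blast
    from this[of "\<lambda>x. c (Inr (P,x))"] calculation show ?thesis using x unfolding part_def by blast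
  qed
  have "G c = 0" unfolding G_def by (rule sum.neutral) (auto simp: K_def cG)
  with G_eq have "A c * C + B c * D = 0" by (metis neg_equal_0_iff_equal)
  then have AC: "A c * C = - (B c * D)" by (simp add: eq_neg_iff_add_eq_0)
  then have "C dvd B c * D" by (metis dvd_minus_iff dvd_triv_right)
  \<comment> \<open>With \<open>G\<close> gone, primality of \<open>C\<close> shows that only a
    multiple of the trivial syzygy remains.\<close>
  from prime_elem_dvd_multD[OF C(1) this] D(3) have "C dvd B c" by simp
  then obtain T where T: "B c = C * T" by (rule dvdE)
  have "C * A c = C * (- (T * D))" using AC by (simp add: T ac_simps)
  then have AT: "A c = - (T * D)" using mult_left_cancel[OF C0] by blast
  \<comment> \<open>Otherwise the leading coefficient of \<open>T D\<close> sits at a monomial where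
    the normalization made \<open>A\<close> vanish.\<close>
  have "T = 0"
  proof (rule ccontr)
    assume T0: "T \<noteq> 0"
    then have "homogeneous (C * T) (e + t)" "C * T \<noteq> 0" using homB[of c] T C0 by auto
    then obtain a b where ab: "homogeneous C a" "homogeneous T b" "a + b = e + t" by (rule homogeneous_factors)
    then have homT: "homogeneous T t" using homogeneous_unique[OF C(2) ab(1) C0] by simp
    have "Max (Poly_Mapping.keys T) \<in> Poly_Mapping.keys T" using T0 by simp
    then have "Max (Poly_Mapping.keys T) \<in> monomials t" using homT by (auto simp: homogeneous_def monomials_def)
    then have "Poly_Mapping.lookup (A c) (Max (Poly_Mapping.keys D) + Max (Poly_Mapping.keys T)) = 0"
      using sol[of "Inr (Inr (Inr (Max (Poly_Mapping.keys T))))"] by (simp add: E_def J_def Plus_def)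
    then show False
      using lookup_mult_Max[OF D(1) T0] by (simp add: AT mult.commute)
  qed
  then have zero: "A c = 0" "B c = 0" using T AT by auto
  have "c i = 0" if i: "i \<in> I" for i
  proof -
    consider k where "k \<in> monomials (f + t)" "i = Inl (Inl k)" | k where "k \<in> monomials (e + t)" "i = Inl (Inr k)"
      | P x where "P \<in> Z" "x \<in> small_pairs (m P + n P)" "i = Inr (P,x)"
      using i by (auto simp: I_def K_def)
    then show ?thesis
    proof cases
      case 1
      then show ?thesis using lookup_form_of[OF 1(1), of "\<lambda>k. c (Inl (Inl k))"] zero by (simp add: A_def)
    next
      case 2
      then show ?thesis using lookup_form_of[OF 2(1), of "\<lambda>k. c (Inl (Inr k))"] zero by (simp add: B_def)
    next
      case 3
      then show ?thesis by (simp add: cG)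
    qed
  qed
  with c show False by blast
qed

section \<open>Polar curves\<close>

text \<open>The partial derivative in the third variable. At exponent 0 the truncated
  \<open>- 1\<close> is harmless because the coefficient is 0.\<close>

definition deriv_Z :: "'a::comm_ring_1 poly3 \<Rightarrow> 'a poly3" where
  "deriv_Z F = (\<Sum>m\<in>Poly_Mapping.keys F.
     Poly_Mapping.single (fst m, fst (snd m), snd (snd m) - 1) (of_nat (snd (snd m)) * Poly_Mapping.lookup F m))"

lemma lookup_deriv_Z:
  "Poly_Mapping.lookup (deriv_Z F) (i,j,l) = of_nat (Suc l) * Poly_Mapping.lookup F (i, j, Suc l)"
proof -
  have "Poly_Mapping.lookup (deriv_Z F) (i,j,l)
      = (\<Sum>m\<in>Poly_Mapping.keys F. if m = (i, j, Suc l) then of_nat (Suc l) * Poly_Mapping.lookup F m else 0)"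
    unfolding deriv_Z_def lookup_sum
    by (rule sum.cong) (auto simp: lookup_single when_def split: nat_diff_split)
  then show ?thesis by (auto simp: in_keys_iff)
qed

lemma deriv_Z_add: "deriv_Z (F + G) = deriv_Z F + deriv_Z G"
proof (rule poly_mapping_eqI)
  fix m show "Poly_Mapping.lookup (deriv_Z (F + G)) m = Poly_Mapping.lookup (deriv_Z F + deriv_Z G) m"
    by (cases m) (simp only: lookup_deriv_Z lookup_add distrib_left)
qed

lemma deriv_Z_single:
  "deriv_Z (Poly_Mapping.single (i,j,l) c) = Poly_Mapping.single (i, j, l - 1) (of_nat l * c)"
proof (rule poly_mapping_eqI)
  fix m show "Poly_Mapping.lookup (deriv_Z (Poly_Mapping.single (i,j,l) c)) m
      = Poly_Mapping.lookup (Poly_Mapping.single (i, j, l - 1) (of_nat l * c)) m"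
    by (cases m; cases l) (auto simp: lookup_deriv_Z lookup_single when_def)
qed

lemma deriv_Z_mult: "deriv_Z (F * G) = deriv_Z F * G + F * deriv_Z G"
proof (induction F rule: poly3_induct)
  case (monom m c)
  show ?case
  proof (induction G rule: poly3_induct)
    case (monom m' c')
    obtain i j l i' j' l' where "m = (i,j,l)" "m' = (i',j',l')" by (cases m; cases m')
    then show ?case
      by (cases l; cases l') (simp_all add: Poly_Mapping.mult_single deriv_Z_single algebra_simps flip: single_add)
  qed (simp add: deriv_Z_add distrib_left)
qed (simp add: deriv_Z_add distrib_right algebra_simps)

lemma keys_deriv_Z: "(i,j,l) \<in> Poly_Mapping.keys (deriv_Z F) \<Longrightarrow> (i, j, Suc l) \<in> Poly_Mapping.keys F"
  by (metis in_keys_iff lookup_deriv_Z mult_zero_right)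

text \<open>By the Leibniz rule every summand of the derivative of a product loses at most one
  factor from \<open>I\<close>.\<close>

lemma derivation_ideal_power:
  assumes add: "\<And>F G. \<delta> (F + G) = \<delta> F + \<delta> G" and mult: "\<And>F G. \<delta> (F * G) = \<delta> F * G + F * \<delta> G"
  shows "F \<in> ideal_power I (Suc k) \<Longrightarrow> \<delta> F \<in> ideal_power I k"
proof (induction k arbitrary: F)
  case (Suc k)
  have \<delta>0: "\<delta> 0 = 0" using add[of 0 0] by simp
  from Suc.prems show ?case
    unfolding ideal_power.simps(2)[of I "Suc k"] ideal_prod_def
  proof (induction F rule: ideal_gen.induct)
    case zero
    show ?case unfolding \<delta>0 by (rule ideal_power_0_mem)
  next
    case (step s f r)
    then obtain a b where s: "s = a * b" and a: "a \<in> ideal_power I (Suc k)" and b: "b \<in> I" by blast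
    \<comment> \<open>These are the Leibniz summands of \<open>r a b + f\<close>: either
      \<open>a\<close> survives, or \<open>\<delta> a\<close> has lost one factor and
      \<open>b\<close> makes up for it.\<close>
    have "\<delta> r * b * a + (r * (\<delta> a * b) + r * \<delta> b * a) + \<delta> f \<in> ideal_power I (Suc k)"
      by (intro ideal_power_add ideal_power_mult_left ideal_power_Suc_mult Suc.IH a b step.IH)
    then show ?case by (simp add: add mult s algebra_simps)
  qed
qed simp

context frame begin

text \<open>The derivative in the direction of the frame's center \<open>P\<close>.\<close>

definition polar :: "'a poly3 \<Rightarrow> 'a poly3" where
  "polar F = from_frame (deriv_Z (to_frame F))"

lemma polar_add: "polar (F + G) = polar F + polar G"
  by (simp add: polar_def to_frame.hom_add from_frame.hom_add deriv_Z_add)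

lemma polar_mult: "polar (F * G) = polar F * G + F * polar G"
  by (simp add: polar_def to_frame.hom_mult from_frame.hom_add from_frame.hom_mult deriv_Z_mult)

lemma homogeneous_polar:
  assumes "homogeneous F n"
  shows "homogeneous (polar F) (n - 1)"
proof -
  have "homogeneous (deriv_Z (to_frame F)) (n - 1)"
    unfolding homogeneous_def
  proof
    fix m assume m: "m \<in> Poly_Mapping.keys (deriv_Z (to_frame F))"
    obtain i j l where ijl: "m = (i,j,l)" by (cases m)
    have "mdeg (i, j, Suc l) = n"
      using keys_deriv_Z m ijl homogeneous_to_frame[OF assms] unfolding homogeneous_def by blast
    then show "mdeg m = n - 1" by (auto simp: ijl)
  qed
  then show ?thesis unfolding polar_def by (rule homogeneous_from_frame)
qed

text \<open>In frame coordinates the derivative leaves the exponents of the first two variables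
  alone, so no multiplicity is lost at the center. This gain over \<open>polar_other\<close> makes
  the estimate for components strict.\<close>

lemma polar_center:
  assumes "F \<in> ideal_power (point_ideal P) k"
  shows "polar F \<in> ideal_power (point_ideal P) k"
proof -
  have "vanishes k (deriv_Z (to_frame F))"
    unfolding vanishes_def
  proof
    fix m assume m: "m \<in> Poly_Mapping.keys (deriv_Z (to_frame F))"
    obtain i j l where ijl: "m = (i,j,l)" by (cases m)
    have "k \<le> vorder (i, j, Suc l)"
      using keys_deriv_Z m ijl assms unfolding point_ideal_power_iff vanishes_def by blast
    then show "k \<le> vorder m" by (simp add: ijl vorder_def)
  qed
  then show ?thesis by (simp add: polar_def point_ideal_power_iff)
qed

lemma polar_other:
  "F \<in> ideal_power (point_ideal Q) k \<Longrightarrow> polar F \<in> ideal_power (point_ideal Q) (k - 1)"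
  using derivation_ideal_power[of polar F "point_ideal Q" "k - 1"] polar_add polar_mult by (cases k) auto

lemma center_nonzero: "P \<noteq> (0,0,0)"
  using dual(9) by (auto simp: lin_def)

lemma cross_center_nonzero:
  assumes "lin A Q \<noteq> 0 \<or> lin B Q \<noteq> 0"
  shows "cross P Q \<noteq> (0,0,0)"
proof
  assume "cross P Q = (0,0,0)"
  moreover have "Q \<noteq> (0,0,0)" using assms by (auto simp: lin_def)
  ultimately have "proportional P Q" by (rule cross_eq_0_imp_proportional[OF _ center_nonzero])
  then obtain c where c: "Q = (c * fst P, c * fst (snd P), c * snd (snd P))" by (auto simp: proportional_def)
  have "lin L Q = c * lin L P" for L by (simp add: c lin_def algebra_simps)
  then show False using assms dual by simp
qed

text \<open>Order and degree are both \<open>n\<close>, which leaves no room for the third variable: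
  \<open>F\<close> is a binary form in frame coordinates, a cone with vertex
  \<open>P\<close>.\<close>

lemma cone_keys:
  assumes "F \<in> ideal_power (point_ideal P) n" "homogeneous F n" "m \<in> Poly_Mapping.keys (to_frame F)"
  shows "snd (snd m) = 0" "fst m + fst (snd m) = n"
proof -
  have "n \<le> vorder m" using assms(1,3) by (auto simp: point_ideal_power_iff vanishes_def)
  moreover have "mdeg m = n" using homogeneous_to_frame[OF assms(2)] assms(3) by (auto simp: homogeneous_def)
  ultimately show "snd (snd m) = 0" "fst m + fst (snd m) = n" by (auto simp: vorder_def mdeg_def)
qed

end

text \<open>In characteristic zero a vanishing derivative kills all monomials containing the third
  variable, so every remaining monomial has full order.\<close>

lemma (in frame) polar_eq_0_imp_cone:
  assumes "polar F = 0" "homogeneous F n" and char0: "\<And>l. (of_nat (Suc l) :: 'a) \<noteq> 0"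
  shows "F \<in> ideal_power (point_ideal P) n"
  unfolding point_ideal_power_iff vanishes_def
proof
  fix m assume m: "m \<in> Poly_Mapping.keys (to_frame F)"
  have d0: "deriv_Z (to_frame F) = 0"
    using assms(1) by (metis polar_def to_from_frame to_frame.hom_zero)
  obtain i j l where ijl: "m = (i,j,l)" by (cases m)
  have "l = 0"
  proof (cases l)
    case (Suc l')
    then show ?thesis
      using lookup_deriv_Z[of "to_frame F" i j l'] d0 m char0[of l'] by (simp add: ijl in_keys_iff del: of_nat_Suc)
  qed
  moreover have "mdeg m = n" using homogeneous_to_frame[OF assms(2)] m by (auto simp: homogeneous_def)
  ultimately show "n \<le> vorder m" by (simp add: ijl vorder_def)
qed

lemma Y3_dvd:
  fixes F :: "'a::comm_ring_1 poly3"
  assumes "\<And>m. m \<in> Poly_Mapping.keys F \<Longrightarrow> fst (snd m) > 0"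
  shows "Y3 dvd F"
proof -
  have "Y3 dvd Poly_Mapping.single m (Poly_Mapping.lookup F m)" if mem: "m \<in> Poly_Mapping.keys F" for m
  proof -
    obtain i j l where m: "m = (i, Suc j, l)" using assms[OF mem] by (cases m) (auto simp: gr0_conv_Suc)
    have "Poly_Mapping.single m (Poly_Mapping.lookup F m) = Y3 * Poly_Mapping.single (i,j,l) (Poly_Mapping.lookup F m)"
      by (simp add: Y3_def Poly_Mapping.mult_single m)
    then show ?thesis by (metis dvd_triv_left)
  qed
  then have "Y3 dvd (\<Sum>m\<in>Poly_Mapping.keys F. Poly_Mapping.single m (Poly_Mapping.lookup F m))"
    by (rule dvd_sum)
  then show ?thesis by (simp add: sum_single_lookup)
qed

text \<open>The locale works over arbitrary fields, so existence of roots enters through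
  \<open>ac\<close>. Either \<open>U\<close> is a zero, or setting the second frame coordinate to 1
  on the line \<open>U V\<close> leaves a univariate polynomial of degree \<open>n\<close>.\<close>

lemma (in frame) ex_cone_zero:
  assumes ac: "\<And>f. f n \<noteq> (0::'a) \<Longrightarrow> \<exists>x. (\<Sum>k\<le>n. f k * x ^ k) = 0"
    and F: "F \<in> ideal_power (point_ideal P) n" "homogeneous F n"
  shows "\<exists>Q. peval F Q = 0 \<and> cross P Q \<noteq> (0,0,0)"
proof (cases "Poly_Mapping.lookup (to_frame F) (n,0,0) = 0")
  case True
  then have "peval F U = 0"
    using peval_X_unit[OF homogeneous_to_frame[OF F(2)]] peval_to_frame[of F 1 0 0] by simp
  then show ?thesis using cross_center_nonzero[of U] dual by (intro exI[of _ U]) simp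
next
  case False
  then obtain x where x: "(\<Sum>k\<le>n. Poly_Mapping.lookup (to_frame F) (k, n - k, 0) * x ^ k) = 0"
    using ac[of "\<lambda>k. Poly_Mapping.lookup (to_frame F) (k, n - k, 0)"] by auto
  let ?h = "\<lambda>k. (k, n - k, 0::nat)"
  have sub: "Poly_Mapping.keys (to_frame F) \<subseteq> ?h ` {..n}"
  proof
    fix m assume "m \<in> Poly_Mapping.keys (to_frame F)"
    from cone_keys[OF F this] show "m \<in> ?h ` {..n}"
      by (intro image_eqI[of _ _ "fst m"]) (auto simp: prod_eq_iff)
  qed
  have "peval (to_frame F) (x,1,0) = (\<Sum>m\<in>?h ` {..n}. Poly_Mapping.lookup (to_frame F) m * mono_eval x 1 0 m)"
    unfolding peval_eq_eval3 using sub by (simp add: eval3_superset[OF ring_hom_id])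
  also have "\<dots> = (\<Sum>k\<le>n. Poly_Mapping.lookup (to_frame F) (k, n - k, 0) * x ^ k)"
    by (subst sum.reindex) (auto simp: inj_on_def mono_eval_def)
  also have "\<dots> = 0" by (fact x)
  finally have "peval F (x * fst U + fst V, x * fst (snd U) + fst (snd V), x * snd (snd U) + snd (snd V)) = 0"
    by (simp add: peval_to_frame)
  moreover have "lin B (x * fst U + fst V, x * fst (snd U) + fst (snd V), x * snd (snd U) + snd (snd V))
      = x * lin B U + lin B V"
    by (simp add: lin_def algebra_simps)
  ultimately show ?thesis
    using cross_center_nonzero dual by (metis add_0 mult_zero_right zero_neq_one)
qed

text \<open>A cone with vertex \<open>P\<close> contains the line joining \<open>P\<close> to any
  other zero \<open>Q\<close>.\<close>

lemma cone_has_linear_factor: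
  fixes F :: "'a::alg_closed_field poly3"
  assumes P: "P \<noteq> (0,0,0)" and n: "n > 0" and F: "F \<in> ideal_power (point_ideal P) n" "homogeneous F n"
  obtains L where "L \<noteq> (0,0,0)" "linear_form L dvd F"
proof -
  from P obtain U V A B W where "frame P U V A B W" by (rule ex_frame)
  then interpret F: frame P U V A B W .
  have "\<exists>Q. peval F Q = 0 \<and> cross P Q \<noteq> (0,0,0)"
    by (rule F.ex_cone_zero[OF alg_closed[OF n] F])
  then obtain Q where Q: "peval F Q = 0" "cross P Q \<noteq> (0,0,0)" by blast
  \<comment> \<open>In the frame with \<open>Q\<close> as second basis vector, \<open>F\<close> is a
    binary form without the pure power of the first variable, hence divisible by the second one,
    which corresponds to the line \<open>B'\<close> through \<open>P\<close> and
    \<open>Q\<close>.\<close>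
  from Q(2) obtain V' A' B' W' where "frame P Q V' A' B' W'" by (rule ex_frame2)
  then interpret frame P Q V' A' B' W' .
  have l0: "Poly_Mapping.lookup (to_frame F) (n,0,0) = 0"
    using peval_X_unit[OF homogeneous_to_frame[OF F(2)]] peval_to_frame[of F 1 0 0] Q(1) by simp
  have "Y3 dvd to_frame F"
  proof (rule Y3_dvd, rule ccontr)
    fix m assume m: "m \<in> Poly_Mapping.keys (to_frame F)" "\<not> fst (snd m) > 0"
    then have "m = (n,0,0)" using cone_keys[OF F m(1)] by (cases m) auto
    with m l0 show False by (simp add: in_keys_iff)
  qed
  then obtain G where "to_frame F = Y3 * G" by (rule dvdE)
  then have "F = from_frame (Y3 * G)" by (metis from_to_frame)
  then have "linear_form B' dvd F" by (simp add: from_frame.hom_mult)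
  moreover have "B' \<noteq> (0,0,0)" using dual(5) by (auto simp: lin_def)
  ultimately show thesis using that by blast
qed

section \<open>Components of degree at least two\<close>

text \<open>A component of degree at least two could be traded for a form of degree two less at the
  cost of one in each multiplicity, contrary to \<open>min\<close>. Writing \<open>n + 2 = d\<close>
  avoids truncated subtraction.\<close>

lemma no_component_of_higher_degree:
  fixes Z :: "('a::{alg_closed_field, field_char_0}) pt set"
  assumes Z: "finite Z" "\<forall>P\<in>Z. P \<noteq> (0,0,0)" "\<forall>P\<in>Z. \<forall>Q\<in>Z. proportional P Q \<longrightarrow> P = Q"
    and F: "F \<noteq> 0" "homogeneous F d" "F \<in> fat_ideal Z k"
    and min: "\<And>G n. G \<noteq> 0 \<Longrightarrow> homogeneous G n \<Longrightarrow> n + 2 = d \<Longrightarrow> G \<notin> fat_ideal Z (k - 1)"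
    and C: "irreducible C" "homogeneous C e" "C dvd F"
  shows "e < 2"
proof (rule ccontr)
  assume "\<not> e < 2"
  then have e: "e \<ge> 2" by simp
  obtain G where FG: "F = C * G" using C(3) by (rule dvdE)
  have nz: "C \<noteq> 0" "G \<noteq> 0" using FG F(1) by auto
  obtain a l where al: "homogeneous C a" "homogeneous G l" "a + l = d"
    using homogeneous_factors[of C G d] F FG by metis
  then have el: "e + l = d" using homogeneous_unique[OF C(2) al(1) nz(1)] by simp
  define m where "m P = mult_at P C" for P
  have memC: "C \<in> ideal_power (point_ideal P) (m P)" if "P \<in> Z" for P
    using point_ideal_power_iff_mult_at[OF _ nz(1), of P] Z(2) that by (auto simp: m_def)
  have prime: "prime_elem C" using C(1) by (rule irreducible_imp_prime_poly3)
  \<comment> \<open>Strictness is essential: the form \<open>H\<close> needs more coefficients than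
    conditions.\<close>
  have "(\<Sum>P\<in>Z. m P * (m P - 1)) < e * (e - 1)"
  proof (cases "\<forall>P\<in>Z. m P = 0")
    case True
    then show ?thesis using e by simp
  next
    case False
    then obtain Q where Q: "Q \<in> Z" "m Q > 0" by auto
    have Q0: "Q \<noteq> (0,0,0)" using Q Z by blast
    then obtain U V A B W where "frame Q U V A B W" by (rule ex_frame)
    then interpret frame Q U V A B W .
    \<comment> \<open>Otherwise \<open>C\<close> is a cone with vertex \<open>Q\<close> and has a
      linear factor, impossible for an irreducible form of degree at least two.\<close>
    have D0: "polar C \<noteq> 0"
    proof
      assume "polar C = 0"
      then have "C \<in> ideal_power (point_ideal Q) e"
        by (rule polar_eq_0_imp_cone[OF _ C(2)]) (simp del: of_nat_Suc)
      then obtain L where L: "L \<noteq> (0,0,0)" "linear_form L dvd C"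
        using cone_has_linear_factor[OF Q0 _ _ C(2)] e by auto
      then obtain H where H: "C = linear_form L * H" by (metis dvdE)
      then have "linear_form L dvd 1 \<or> H dvd 1" using C(1) irreducibleD by blast
      moreover have LL: "\<not> linear_form L dvd 1"
      proof
        assume "linear_form L dvd 1"
        then obtain K where K: "linear_form L * K = 1" by (metis dvdE)
        then obtain a b where ab: "homogeneous (linear_form L) a" "a + b = 0"
          using homogeneous_factors[of "linear_form L" K 0] by (metis homogeneous_1 one_neq_zero)
        then show False using homogeneous_unique[OF ab(1) homogeneous_linear_form] L(1) by simp
      qed
      moreover have "\<not> H dvd 1"
      proof
        assume "H dvd 1"
        then obtain K where K: "H * K = 1" by (metis dvdE)
        then obtain b b' where b: "homogeneous H b" "b + b' = 0"
          using homogeneous_factors[of H K 0] by (metis homogeneous_1 one_neq_zero)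
        then have "homogeneous C (1 + 0)" unfolding H by (intro homogeneous_mult homogeneous_linear_form) auto
        then show False using homogeneous_unique[OF C(2) _ nz(1)] e by fastforce
      qed
      ultimately show False by blast
    qed
    have homD: "homogeneous (polar C) (e - 1)" using C(2) by (rule homogeneous_polar)
    have nd: "\<not> C dvd polar C"
    proof
      assume "C dvd polar C"
      then obtain T where T: "polar C = C * T" by (rule dvdE)
      then obtain a b where "homogeneous C a" "a + b = e - 1"
        using homogeneous_factors[of C T "e - 1"] homD D0 by metis
      then show False using homogeneous_unique[OF C(2) _ nz(1), of a] e by simp
    qed
    \<comment> \<open>The polar with center \<open>Q\<close> keeps the full multiplicity at
      \<open>Q\<close> and loses at most one elsewhere.\<close>
    define n where "n P = (if P = Q then m P else m P - 1)" for P
    have "(\<Sum>P\<in>Z. m P * n P) \<le> e * (e - 1)"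
    proof (rule bezout_inequality[OF Z prime C(2) D0 homD nd memC])
      fix P assume "P \<in> Z"
      then show "polar C \<in> ideal_power (point_ideal P) (n P)"
        using memC[of P] polar_center[of C] polar_other[of C P] by (auto simp: n_def)
    qed
    \<comment> \<open>Since \<open>m Q > 0\<close>, the summand at \<open>Q\<close> is strictly
      larger.\<close>
    moreover have "(\<Sum>P\<in>Z. m P * (m P - 1)) < (\<Sum>P\<in>Z. m P * n P)"
      by (rule sum_strict_mono_ex1) (use Z(1) Q in \<open>auto simp: n_def intro!: bexI[of _ Q]\<close>)
    ultimately show ?thesis by simp
  qed
  moreover have "2 * (\<Sum>P\<in>Z. card (small_pairs (m P - 1))) = (\<Sum>P\<in>Z. m P * (m P - 1))"
    unfolding sum_distrib_left
  proof (rule sum.cong[OF refl])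
    fix P show "2 * card (small_pairs (m P - 1)) = m P * (m P - 1)"
      by (cases "m P") (simp_all add: card_small_pairs)
  qed
  moreover have "2 * card (monomials (e - 2)) = e * (e - 1)"
  proof -
    obtain e' where "e = e' + 2" using e by (metis add.commute le_Suc_ex)
    then show ?thesis using card_monomials[of e'] by (simp add: algebra_simps)
  qed
  ultimately have "(\<Sum>P\<in>Z. card (small_pairs (m P - 1))) < card (monomials (e - 2))" by linarith
  then obtain H where H: "H \<noteq> 0" "homogeneous H (e - 2)" "\<forall>P\<in>Z. H \<in> ideal_power (point_ideal P) (m P - 1)"
    by (rule ex_form_with_multiplicities[OF Z(1,2)])
  have GH: "G * H \<noteq> 0" using nz H by simp
  have "G * H \<in> fat_ideal Z (k - 1)"
    unfolding fat_ideal_iff[OF Z(2) GH]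
  proof
    fix P assume P: "P \<in> Z"
    then have P0: "P \<noteq> (0,0,0)" using Z by blast
    have "k \<le> mult_at P F" using F P fat_ideal_iff[OF Z(2) F(1)] by blast
    also have "\<dots> = m P + mult_at P G" unfolding FG m_def by (rule mult_at_mult[OF P0 nz])
    finally have "k \<le> m P + mult_at P G" .
    moreover have "m P - 1 \<le> mult_at P H" using H P point_ideal_power_iff_mult_at[OF P0 H(1)] by blast
    ultimately show "k - 1 \<le> mult_at P (G * H)"
      using mult_at_mult[OF P0 nz(2) H(1)] by simp
  qed
  moreover have "homogeneous (G * H) (l + (e - 2))" using al H by (intro homogeneous_mult)
  moreover have "l + (e - 2) + 2 = d" using el e by simp
  ultimately show False using min[OF GH] by blast
qed

section \<open>Line arrangements\<close>

text \<open>A multiset, since the lines of the form may be repeated.\<close>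

definition line_product :: "'a::comm_ring_1 pt multiset \<Rightarrow> 'a poly3" where
  "line_product X = (\<Prod>L\<in>#X. linear_form L)"

definition lines_through :: "'a::comm_ring_1 pt \<Rightarrow> 'a pt multiset \<Rightarrow> nat" where
  "lines_through P X = size (filter_mset (\<lambda>L. lin L P = 0) X)"

lemma line_product_nonzero:
  fixes X :: "'a::field pt multiset"
  shows "(0,0,0) \<notin># X \<Longrightarrow> line_product X \<noteq> 0"
  by (induction X) (auto simp: line_product_def)

lemma homogeneous_line_product: "homogeneous (line_product X) (size X)"
proof (induction X)
  case (add L X)
  then show ?case
    using homogeneous_mult[OF homogeneous_linear_form, of "line_product X" "size X" L] by (simp add: line_product_def)
qed (simp add: line_product_def)

lemma mult_at_line_product:
  fixes P :: "'a::field pt"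
  assumes "P \<noteq> (0,0,0)"
  shows "(0,0,0) \<notin># X \<Longrightarrow> mult_at P (line_product X) = lines_through P X"
proof (induction X)
  case empty
  show ?case using assms by (simp add: line_product_def lines_through_def)
next
  case (add L X)
  then have "line_product X \<noteq> 0" "L \<noteq> (0,0,0)" using line_product_nonzero[of X] by auto
  then show ?case
    using add mult_at_mult[OF assms, of "linear_form L" "line_product X"]
    by (simp add: line_product_def lines_through_def mult_at_linear_form[OF assms])
qed

text \<open>A homogeneous factor of least positive degree is irreducible, hence linear by
  \<open>irr\<close>. Splitting it off leaves a quotient that still divides the fixed
  \<open>F\<close>, so the induction continues.\<close>

lemma splits_into_lines:
  fixes F :: "'a::field poly3"
  assumes irr: "\<And>C e. irreducible C \<Longrightarrow> homogeneous C e \<Longrightarrow> C dvd F \<Longrightarrow> e < 2"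
    and G: "homogeneous G n" "G \<noteq> 0" "G dvd F"
  shows "\<exists>X c. (0,0,0) \<notin># X \<and> size X = n \<and> G = const3 c * line_product X"
  using G
proof (induction n arbitrary: G rule: less_induct)
  case (less n)
  show ?case
  proof (cases "n = 0")
    case True
    then obtain c where "G = const3 c" using less.prems homogeneous_0E by metis
    then show ?thesis using True by (intro exI[of _ "{#}"] exI[of _ c]) (simp add: line_product_def)
  next
    case False
    define Q where "Q e \<longleftrightarrow> e > 0 \<and> (\<exists>C. homogeneous C e \<and> C dvd G)" for e
    define e where "e = (LEAST e. Q e)"
    have "Q n" using False less.prems by (auto simp: Q_def)
    then have "Q e" unfolding e_def by (rule LeastI)
    then obtain C where C: "e > 0" "homogeneous C e" "C dvd G" by (auto simp: Q_def)
    obtain H where H: "G = C * H" using C(3) by (rule dvdE)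
    then have nz: "C \<noteq> 0" "H \<noteq> 0" using less.prems(2) by auto
    have "irreducible C"
    proof (rule irreducible_if_no_homogeneous_factor[OF C(2) nz(1) C(1)])
      fix D j assume "D dvd C" "homogeneous D j" "j > 0"
      then have "Q j" using C(3) by (auto simp: Q_def intro: dvd_trans)
      then show "e \<le> j" unfolding e_def by (rule Least_le)
    qed
    then have "e < 2" using irr[of C e] C less.prems(3) dvd_trans by blast
    then have e1: "e = 1" using C by simp
    then obtain L where L: "C = linear_form L" using C(2) homogeneous_1E by blast
    obtain a l where al: "homogeneous C a" "homogeneous H l" "a + l = n"
      using homogeneous_factors[of C H n] less.prems H by metis
    then have ln: "1 + l = n" using homogeneous_unique[OF C(2) al(1) nz(1)] e1 by simp
    have "H dvd F" using less.prems(3) H by (metis dvd_mult_right)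
    then obtain X c where X: "(0,0,0) \<notin># X" "size X = l" "H = const3 c * line_product X"
      using less.IH[of l H] ln al nz by auto
    have "L \<noteq> (0,0,0)" using nz L by auto
    then show ?thesis
      using X ln by (intro exI[of _ "add_mset L X"] exI[of _ c]) (simp add: H L line_product_def mult.left_commute)
  qed
qed

section \<open>Incidence of points and lines\<close>

lemma proportional_refl: "proportional P P"
  unfolding proportional_def by (intro exI[of _ 1]) simp

lemma proportional_trans: "proportional P Q \<Longrightarrow> proportional Q R \<Longrightarrow> proportional P R"
  unfolding proportional_def
proof (elim exE conjE)
  fix c d assume "c \<noteq> 0" "d \<noteq> 0" "Q = (c * fst P, c * fst (snd P), c * snd (snd P))"
    "R = (d * fst Q, d * fst (snd Q), d * snd (snd Q))"
  then show "\<exists>c. c \<noteq> 0 \<and> R = (c * fst P, c * fst (snd P), c * snd (snd P))"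
    by (intro exI[of _ "d * c"]) simp
qed

lemma lin_proportional: "proportional P Q \<Longrightarrow> lin L P = 0 \<longleftrightarrow> lin L Q = 0"
proof -
  assume "proportional P Q"
  then obtain c where c: "c \<noteq> 0" "Q = (c * fst P, c * fst (snd P), c * snd (snd P))"
    by (auto simp: proportional_def)
  then have "lin L Q = c * lin L P" by (simp add: lin_def algebra_simps)
  with c show ?thesis by simp
qed

lemma lin_commute: "lin L P = lin P L"
  by (simp add: lin_def mult.commute)

text \<open>The vector triple product expands \<open>cross P (cross L M)\<close> in terms of
  \<open>lin L P\<close> and \<open>lin M P\<close>, which both vanish.\<close>

lemma proportional_cross:
  fixes P L M :: "'a::field pt"
  assumes "lin L P = 0" "lin M P = 0" "P \<noteq> (0,0,0)" "cross L M \<noteq> (0,0,0)"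
  shows "proportional P (cross L M)"
proof -
  have "cross P (cross L M) = (fst L * lin M P - fst M * lin L P, fst (snd L) * lin M P - fst (snd M) * lin L P,
      snd (snd L) * lin M P - snd (snd M) * lin L P)"
    by (simp add: cross_def lin_def algebra_simps)
  then have "cross P (cross L M) = (0,0,0)" using assms by simp
  then show ?thesis using assms cross_eq_0_imp_proportional by blast
qed

lemma lines_meet_once:
  fixes P Q L M :: "'a::field pt"
  assumes "\<not> proportional L M" "L \<noteq> (0,0,0)" "M \<noteq> (0,0,0)" "P \<noteq> (0,0,0)" "Q \<noteq> (0,0,0)"
    "lin L P = 0" "lin M P = 0" "lin L Q = 0" "lin M Q = 0"
  shows "proportional P Q"
proof -
  have "cross L M \<noteq> (0,0,0)" using cross_eq_0_imp_proportional assms(1-3) by blast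
  then show ?thesis
    using proportional_cross[of L P M] proportional_cross[of L Q M] assms
    by (meson proportional_sym proportional_trans)
qed

text \<open>Take a line through each point \<open>k\<close> times. Consequently the minimum in
  \<open>initial_degree\<close> is attained.\<close>

lemma ex_fat_form:
  fixes Z :: "'a::field pt set"
  assumes Z: "finite Z" "\<forall>P\<in>Z. P \<noteq> (0,0,0)"
  shows "\<exists>n. \<exists>F\<in>fat_ideal Z k. F \<noteq> 0 \<and> homogeneous F n"
proof -
  have "\<forall>P\<in>Z. \<exists>L. L \<noteq> (0,0,0) \<and> lin L P = 0"
  proof
    fix P assume "P \<in> Z"
    then have "P \<noteq> (0,0,0)" using Z by blast
    then obtain U V A B W where "frame P U V A B W" by (rule ex_frame)
    then have "lin A P = 0" "lin A U = 1" by (simp_all add: frame_def)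
    then show "\<exists>L. L \<noteq> (0,0,0) \<and> lin L P = 0" by (intro exI[of _ A]) (auto simp: lin_def)
  qed
  from bchoice[OF this] obtain \<Lambda> where \<Lambda>: "\<And>P. P \<in> Z \<Longrightarrow> \<Lambda> P \<noteq> (0,0,0) \<and> lin (\<Lambda> P) P = 0" by blast
  let ?F = "\<Prod>P\<in>Z. linear_form (\<Lambda> P) ^ k"
  have F0: "?F \<noteq> 0" using Z(1) \<Lambda> by auto
  have "?F \<in> fat_ideal Z k"
    unfolding fat_ideal_iff[OF Z(2) F0]
  proof
    fix P assume P: "P \<in> Z"
    then have P0: "P \<noteq> (0,0,0)" using Z by blast
    have "k = mult_at P (linear_form (\<Lambda> P) ^ k)"
      using \<Lambda>[OF P] P0 by (simp add: mult_at_power mult_at_linear_form)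
    also have "\<dots> \<le> (\<Sum>Q\<in>Z. mult_at P (linear_form (\<Lambda> Q) ^ k))"
      using Z(1) P by (intro member_le_sum) auto
    also have "\<dots> = mult_at P ?F" using \<Lambda> by (intro mult_at_prod[OF P0, symmetric]) auto
    finally show "k \<le> mult_at P ?F" .
  qed
  moreover have "homogeneous ?F (\<Sum>P\<in>Z. k)" by (intro homogeneous_prod homogeneous_linear_form_power)
  ultimately show ?thesis using F0 by blast
qed

lemma size_filter_mset_mono: "(\<And>x. x \<in># X \<Longrightarrow> p x \<Longrightarrow> q x) \<Longrightarrow> size (filter_mset p X) \<le> size (filter_mset q X)"
  by (induction X) auto

theorem theorem3p4:
  fixes Z :: "('a::{alg_closed_field, field_char_0}) pt set" and k :: nat
  assumes "finite Z"
    and "\<forall>P\<in>Z. P \<noteq> (0,0,0)"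
    and "\<forall>P\<in>Z. \<forall>Q\<in>Z. proportional P Q \<longrightarrow> P = Q"
    and "k \<ge> 2"
    and "initial_degree (fat_ideal Z k) = initial_degree (fat_ideal Z (k - 1)) + 1"
  shows "collinear_pts Z \<or> intersection_points_of_arrangement Z"
proof (cases "collinear_pts Z")
  case True
  then show ?thesis ..
next
  case ncol: False
  note Z = assms(1-3)
  define d where "d = initial_degree (fat_ideal Z k)"
  have "\<exists>F\<in>fat_ideal Z k. F \<noteq> 0 \<and> homogeneous F d"
    unfolding d_def initial_degree_def by (rule LeastI_ex) (rule ex_fat_form[OF Z(1,2)])
  then obtain F where F: "F \<noteq> 0" "homogeneous F d" "F \<in> fat_ideal Z k" by blast
  \<comment> \<open>By the gap of one, degree \<open>d - 2\<close> lies just below the initial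
    degree for \<open>k - 1\<close>.\<close>
  have min: "G \<notin> fat_ideal Z (k - 1)" if "G \<noteq> 0" "homogeneous G n" "n + 2 = d" for G n
  proof -
    have "n < (LEAST n. \<exists>F\<in>fat_ideal Z (k - 1). F \<noteq> 0 \<and> homogeneous F n)"
      using that(3) assms(5) unfolding d_def initial_degree_def by simp
    from not_less_Least[OF this] that show ?thesis by blast
  qed
  have "\<exists>X c. (0,0,0) \<notin># X \<and> size X = d \<and> F = const3 c * line_product X"
    by (rule splits_into_lines[OF _ F(2,1) dvd_refl]) (rule no_component_of_higher_degree[OF Z F min])
  then obtain X c where X: "(0,0,0) \<notin># X" "size X = d" "F = const3 c * line_product X" by blast
  have XF: "F dvd line_product X"
  proof -
    have "c \<noteq> 0" using F(1) X(3) by auto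
    have "F * const3 (inverse c) = const3 (c * inverse c) * line_product X"
      by (simp only: X(3) const3.hom_mult ac_simps)
    then have "line_product X = F * const3 (inverse c)" using \<open>c \<noteq> 0\<close> by simp
    then show ?thesis by (metis dvd_triv_left)
  qed
  have through: "k \<le> lines_through P X" if P: "P \<in> Z" for P
  proof -
    have P0: "P \<noteq> (0,0,0)" using Z P by blast
    obtain H where H: "line_product X = F * H" using XF by (rule dvdE)
    then have "H \<noteq> 0" using line_product_nonzero[OF X(1)] by auto
    then have "mult_at P F \<le> lines_through P X"
      using mult_at_line_product[OF P0 X(1)] mult_at_mult[OF P0 F(1), of H] H by simp
    moreover have "k \<le> mult_at P F" using F(3) P fat_ideal_iff[OF Z(2) F(1)] by blast
    ultimately show ?thesis by simp
  qed
  \<comment> \<open>Deleting two lines leaves a nonzero form of degree \<open>d - 2\<close>, so its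
    multiplicity must be too small at some point of \<open>Z\<close>.\<close>
  have remove2: "\<exists>P\<in>Z. lines_through P Y < k - 1" if Y: "X = add_mset L (add_mset M Y)" for L M Y
  proof (rule ccontr)
    assume no: "\<not> ?thesis"
    have Y0: "(0,0,0) \<notin># Y" using X(1) Y by auto
    have "line_product Y \<in> fat_ideal Z (k - 1)"
      unfolding fat_ideal_iff[OF Z(2) line_product_nonzero[OF Y0]]
    proof
      fix P assume P: "P \<in> Z"
      then have "P \<noteq> (0,0,0)" using Z by blast
      with P no show "k - 1 \<le> mult_at P (line_product Y)"
        by (auto simp: mult_at_line_product[OF _ Y0] not_less)
    qed
    moreover have "size Y + 2 = d" using X(2) Y by simp
    ultimately show False using min[OF line_product_nonzero[OF Y0] homogeneous_line_product] by blast
  qed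
  have two: "\<exists>L\<in>#X. \<exists>M\<in>#X. \<not> proportional L M \<and> lin L P = 0 \<and> lin M P = 0" if P: "P \<in> Z" for P
  proof (rule ccontr)
    assume "\<not> ?thesis"
    then have par: "\<And>L M. L \<in># X \<Longrightarrow> M \<in># X \<Longrightarrow> lin L P = 0 \<Longrightarrow> lin M P = 0 \<Longrightarrow> proportional L M" by blast
    have ex: "\<exists>L\<in>#X. lin L Q = 0" if Q: "Q \<in> Z" for Q
    proof (rule ccontr)
      assume "\<not> ?thesis"
      then have "lines_through Q X = 0" by (auto simp: lines_through_def)
      then show False using through[OF Q] assms(4) by simp
    qed
    obtain L where L: "L \<in># X" "lin L P = 0" using ex[OF P] by blast
    then have "L \<noteq> (0,0,0)" using X by auto
    \<comment> \<open>As \<open>Z\<close> is not collinear, some point \<open>R\<close> lies off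
      \<open>L\<close>; a line \<open>M\<close> of the arrangement through \<open>R\<close> is
      deleted together with \<open>L\<close>.\<close>
    then obtain R where R: "R \<in> Z" "lin L R \<noteq> 0" using ncol unfolding collinear_pts_def by blast
    obtain M where M: "M \<in># X" "lin M R = 0" using ex[OF R(1)] by blast
    have "L \<noteq> M" using R M by auto
    then obtain Y where Y: "X = add_mset L (add_mset M Y)"
      using L M by (metis insert_DiffM insert_noteq_member)
    have "lin M P \<noteq> 0"
    proof
      assume "lin M P = 0"
      then have "proportional L M" using par L M by blast
      then show False using lin_proportional[of L M R] R M by (simp add: lin_commute)
    qed
    \<comment> \<open>Only one of the two deleted lines passes through \<open>P\<close>.\<close>
    then have "lines_through P X = 1 + lines_through P Y" using L by (simp add: Y lines_through_def)
    then have YP: "k - 1 \<le> lines_through P Y" using through[OF P] by simp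
    obtain S where S: "S \<in> Z" "lines_through S Y < k - 1" using remove2[OF Y] by blast
    have XS: "lines_through S X = (if lin L S = 0 then 1 else 0) + (if lin M S = 0 then 1 else 0) + lines_through S Y"
      by (simp add: Y lines_through_def)
    \<comment> \<open>The count at \<open>S\<close> drops from at least \<open>k\<close> to below
      \<open>k - 1\<close>, so both deleted lines pass through \<open>S\<close>.\<close>
    have "lin L S = 0" using XS through[OF S(1)] S(2) by (auto split: if_splits)
    \<comment> \<open>Every remaining line through \<open>P\<close> is the line \<open>L\<close> up
      to a scalar and so contains \<open>S\<close>. Thus \<open>S\<close> keeps at least
      \<open>k - 1\<close> lines, a contradiction.\<close>
    have "lines_through P Y \<le> lines_through S Y"
      unfolding lines_through_def
    proof (rule size_filter_mset_mono)
      fix N assume "N \<in># Y" "lin N P = 0"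
      then have "proportional L N" using par L Y by auto
      then show "lin N S = 0" using lin_proportional[of L N S] \<open>lin L S = 0\<close> by (simp add: lin_commute)
    qed
    then show False using YP S by simp
  qed
  have "intersection_points_of_arrangement Z"
    unfolding intersection_points_of_arrangement_def
  \<comment> \<open>The arrangement consists of the linear factors of \<open>F\<close>, with
    repetitions forgotten.\<close>
  proof (intro exI[of _ "set_mset X"] conjI allI impI)
    show "\<forall>L\<in>#X. L \<noteq> (0,0,0)" using X by auto
    fix P :: "'a pt" assume P: "P \<noteq> (0,0,0)"
    show "(\<exists>Q\<in>Z. proportional Q P) \<longleftrightarrow> (\<exists>L1\<in>#X. \<exists>L2\<in>#X. \<not> proportional L1 L2 \<and> lin L1 P = 0 \<and> lin L2 P = 0)"
    proof
      assume "\<exists>Q\<in>Z. proportional Q P"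
      then show "\<exists>L1\<in>#X. \<exists>L2\<in>#X. \<not> proportional L1 L2 \<and> lin L1 P = 0 \<and> lin L2 P = 0"
        using two lin_proportional by blast
    next
      assume "\<exists>L1\<in>#X. \<exists>L2\<in>#X. \<not> proportional L1 L2 \<and> lin L1 P = 0 \<and> lin L2 P = 0"
      then obtain L M where LM: "L \<in># X" "M \<in># X" "\<not> proportional L M" "lin L P = 0" "lin M P = 0" by blast
      then have "L \<noteq> M" using proportional_refl by blast
      then obtain Y where Y: "X = add_mset L (add_mset M Y)"
        using LM by (metis insert_DiffM insert_noteq_member)
      \<comment> \<open>As before, both deleted lines pass through \<open>S\<close>; being different
        projective lines, they meet only there, so \<open>P\<close> represents the point
        \<open>S\<close> of \<open>Z\<close>.\<close>
      obtain S where S: "S \<in> Z" "lines_through S Y < k - 1" using remove2[OF Y] by blast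
      have "lines_through S X = (if lin L S = 0 then 1 else 0) + (if lin M S = 0 then 1 else 0) + lines_through S Y"
        by (simp add: Y lines_through_def)
      then have "lin L S = 0" "lin M S = 0" using through[OF S(1)] S(2) by (auto split: if_splits)
      moreover have "L \<noteq> (0,0,0)" "M \<noteq> (0,0,0)" "S \<noteq> (0,0,0)" using X LM Z S by auto
      ultimately have "proportional S P" using lines_meet_once[OF LM(3)] LM P by blast
      then show "\<exists>Q\<in>Z. proportional Q P" using S by blast
    qed
  qed simp
  then show ?thesis ..
qed

end
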